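(* Let $u \in H^\infty(\mathbb{D})$ be an inner function and let $X\in\mathcal{B}(\mathcal{Q}_u)$. Then $S_u^*X=XS_u$ if and only if there exists $\varphi\in L^{\infty}(\mathbb{T})$ such that \[ H_{\varphi}=\begin{bmatrix} X&0\\ 0&0 \end{bmatrix} \] with respect to the orthogonal decomposition $H^2=\mathcal{Q}_u\oplus\mathcal{Q}_u^{\perp}$. In particular, if $S_u^*X=XS_u$, then (for such $\varphi$) $X=H_{\varphi}|_{\mathcal{Q}_u}$ and $\|H_\varphi\|=\|X\|$.
   Context: $\mathbb{T}$ is the unit circle, $\mathbb{D}$ the open unit disc, and $\mathcal{B}(\mathcal{H})$ the bounded linear operators on a Hilbert space $\mathcal{H}$. $H^2\subseteq L^2(\mathbb{T})$ is the Hardy space (functions whose negative Fourier coefficients vanish), $P_+$ is the orthogonal projection of $L^2(\mathbb{T})$ onto $H^2$, and $J:L^2(\mathbb{T})\to L^2(\mathbb{T})$ is the unitary $(Jf)(z)=f(\bar z)$. For $\varphi\in L^\infty(\mathbb{T})$, the Hankel operator $H_\varphi\in\mathcal{B}(H^2)$ is $H_\varphi f=P_+(\varphi\, Jf)$. $T_z$ is the shift on $H^2$, $T_zf=zf$. $H^\infty(\mathbb{D})$ is the algebra of bounded analytic functions on $\mathbb{D}$; $u\in H^\infty(\mathbb{D})$ is inner if its radial limits satisfy $|u|=1$ a.e. on $\mathbb{T}$. For $u$ inner, the model space is $\mathcal{Q}_u=H^2\ominus uH^2$ and the model operator is $S_u=P_{\mathcal{Q}_u}T_z|_{\mathcal{Q}_u}\in\mathcal{B}(\mathcal{Q}_u)$,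 where $P_{\mathcal{Q}_u}$ is the orthogonal projection onto $\mathcal{Q}_u$. *)

theory Defs
  imports "HOL-Analysis.Analysis"
begin

section \<open>The unit circle and \<open>L\<^sup>2\<close>\<close>

text \<open>Normalised arc length. The underlying space is the circle itself, so a function
  \<open>complex \<Rightarrow> complex\<close> only matters through its values on the circle.\<close>

definition circle :: "complex measure" where
  "circle = distr (uniform_measure lborel {0..2*pi}) (restrict_space borel (sphere 0 1)) cis"

lemma cis_measurable_circle [measurable]:
  "cis \<in> uniform_measure lborel {0..2*pi} \<rightarrow>\<^sub>M restrict_space borel (sphere 0 1)"
proof (rule measurable_restrict_space2)
  show "cis \<in> borel_measurable (uniform_measure lborel {0..2*pi})"
    using borel_measurable_continuous_onI[of cis] continuous_on_cis[of UNIV "\<lambda>x. x"]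
    by simp
qed auto

lemma space_circle [simp]: "space circle = sphere 0 1"
  by (simp add: circle_def space_restrict_space)

lemma sets_circle [simp, measurable_cong]:
  "sets circle = sets (restrict_space borel (sphere 0 1))"
  by (simp add: circle_def)

lemma emeasure_space_circle: "emeasure circle (space circle) = 1"
proof -
  have "emeasure circle (space circle) = emeasure (uniform_measure lborel {0..2*pi}) UNIV"
    unfolding circle_def
    by (subst emeasure_distr)
       (auto simp: space_restrict_space sets_restrict_space vimage_def)
  also have "\<dots> = 1"
    by (subst emeasure_uniform_measure) (auto simp: ennreal_divide_self)
  finally show ?thesis .
qed

lemma finite_measure_circle: "finite_measure circle"
  by standard (simp add: emeasure_space_circle del: space_circle)

text \<open>Complex conjugation preserves arc length.\<close>

lemma cnj_measurable_circle [measurable]: "cnj \<in> circle \<rightarrow>\<^sub>M circle"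
  unfolding measurable_cong_sets[OF sets_circle sets_circle]
  by (rule measurable_restrict_space3) (auto intro: borel_measurable_continuous_onI continuous_intros)

lemma distr_circle_cnj: "distr circle circle cnj = circle"
proof -
  let ?U = "uniform_measure lborel {0..2*pi}"
  have refl: "distr ?U ?U (\<lambda>t. 2*pi - t) = ?U"
  proof (rule measure_eqI)
    fix A assume "A \<in> sets (distr ?U ?U (\<lambda>t. 2*pi - t))"
    then have A: "A \<in> sets borel" by simp
    have L: "lborel = distr lborel borel (\<lambda>t. 2*pi - t :: real)"
      by (subst lborel_real_affine[of "-1" "2*pi"]) (auto simp: density_1 one_ennreal_def[symmetric])
    have "emeasure lborel ({0..2*pi} \<inter> A)
        = emeasure (distr lborel borel (\<lambda>t. 2*pi - t)) ({0..2*pi} \<inter> A)"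
      using L by simp
    also have "\<dots> = emeasure lborel ((\<lambda>t. 2*pi - t) -` ({0..2*pi} \<inter> A))"
      using A by (subst emeasure_distr) auto
    also have "(\<lambda>t. 2*pi - t) -` ({0..2*pi} \<inter> A) = {0..2*pi} \<inter> (\<lambda>t. 2*pi - t) -` A"
      by auto
    finally show "emeasure (distr ?U ?U (\<lambda>t. 2*pi - t)) A = emeasure ?U A"
      using A measurable_sets_borel[of "\<lambda>t. 2*pi - t" borel A] by (subst emeasure_distr) auto
  qed simp
  have "distr circle circle cnj = distr circle (restrict_space borel (sphere 0 1)) cnj"
    by (rule distr_cong) auto
  also have "\<dots> = distr ?U (restrict_space borel (sphere 0 1)) (cnj \<circ> cis)"
    unfolding circle_def
    by (rule distr_distr) (use cnj_measurable_circle in \<open>simp_all add: measurable_cong_sets[OF sets_circle sets_circle] del: cnj_measurable_circle\<close>)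
  also have "\<dots> = distr ?U (restrict_space borel (sphere 0 1)) (cis \<circ> (\<lambda>t. 2*pi - t))"
    by (rule distr_cong) (auto simp: cis_cnj complex_eq_iff)
  also have "\<dots> = distr (distr ?U ?U (\<lambda>t. 2*pi - t)) (restrict_space borel (sphere 0 1)) cis"
    by (rule distr_distr[symmetric]) (auto simp: cis_measurable_circle)
  also have "\<dots> = circle"
    by (simp add: refl circle_def)
  finally show ?thesis .
qed

definition square_integrable :: "(complex \<Rightarrow> complex) \<Rightarrow> bool" where
  "square_integrable f \<longleftrightarrow>
     f \<in> borel_measurable circle \<and> integrable circle (\<lambda>z. (cmod (f z))\<^sup>2)"

definition L2_rel :: "(complex \<Rightarrow> complex) \<Rightarrow> (complex \<Rightarrow> complex) \<Rightarrow> bool" where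
  "L2_rel f g \<longleftrightarrow> square_integrable f \<and> square_integrable g \<and> (AE z in circle. f z = g z)"

lemma square_integrable_measurable [measurable_dest]:
  "square_integrable f \<Longrightarrow> f \<in> borel_measurable circle"
  by (simp add: square_integrable_def)

lemma square_integrable_zero [simp]: "square_integrable (\<lambda>_. 0)"
  by (simp add: square_integrable_def)

quotient_type L2 = "complex \<Rightarrow> complex" / partial: L2_rel
proof (rule part_equivpI)
  show "\<exists>f. L2_rel f f"
    by (rule exI[of _ "\<lambda>_. 0"]) (simp add: L2_rel_def)
  show "symp L2_rel"
    by (auto simp: symp_def L2_rel_def)
  show "transp L2_rel"
    by (auto simp: transp_def L2_rel_def elim: AE_mp)
qed

lemma square_integrable_times:
  assumes "square_integrable f" "square_integrable g"
  shows "integrable circle (\<lambda>z. f z * g z)"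
proof (rule Bochner_Integration.integrable_bound)
  show "integrable circle (\<lambda>z. (cmod (f z))\<^sup>2 + (cmod (g z))\<^sup>2)"
    using assms by (auto simp: square_integrable_def)
  show "(\<lambda>z. f z * g z) \<in> borel_measurable circle"
    using assms by measurable
  have "a * b \<le> a\<^sup>2 + b\<^sup>2" if "0 \<le> a" "0 \<le> b" for a b :: real
    using sum_squares_bound[of a b] that mult_nonneg_nonneg[OF that] by linarith
  then show "AE z in circle. norm (f z * g z) \<le> norm ((cmod (f z))\<^sup>2 + (cmod (g z))\<^sup>2)"
    by (simp add: norm_mult)
qed

lemma square_integrable_cnj: "square_integrable g \<Longrightarrow> square_integrable (\<lambda>z. cnj (g z))"
  by (auto simp: square_integrable_def 
      intro!: measurable_compose[OF _ borel_measurable_continuous_onI[of cnj]] continuous_intros)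

lemma square_integrable_bounded_times:
  assumes "\<phi> \<in> borel_measurable circle" "AE z in circle. cmod (\<phi> z) \<le> C" "square_integrable f"
  shows "square_integrable (\<lambda>z. \<phi> z * f z)"
  unfolding square_integrable_def
proof
  show m: "(\<lambda>z. \<phi> z * f z) \<in> borel_measurable circle"
    using assms(1,3) by measurable
  show "integrable circle (\<lambda>z. (cmod (\<phi> z * f z))\<^sup>2)"
  proof (rule Bochner_Integration.integrable_bound)
    show "integrable circle (\<lambda>z. C\<^sup>2 * (cmod (f z))\<^sup>2)"
      using assms by (auto simp: square_integrable_def)
    show "(\<lambda>z. (cmod (\<phi> z * f z))\<^sup>2) \<in> borel_measurable circle"
      using m by measurable
    show "AE z in circle. norm ((cmod (\<phi> z * f z))\<^sup>2) \<le> norm (C\<^sup>2 * (cmod (f z))\<^sup>2)"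
      using assms(2) by eventually_elim
        (auto simp: norm_mult power_mult_distrib intro!: mult_right_mono power_mono)
  qed
qed

lemma square_integrable_cmult: "square_integrable f \<Longrightarrow> square_integrable (\<lambda>z. c * f z)"
  by (rule square_integrable_bounded_times[where C="cmod c"]) auto

lemma square_integrable_add:
  assumes "square_integrable f" "square_integrable g"
  shows "square_integrable (\<lambda>z. f z + g z)"
  unfolding square_integrable_def
proof
  show m: "(\<lambda>z. f z + g z) \<in> borel_measurable circle"
    using assms by measurable
  show "integrable circle (\<lambda>z. (cmod (f z + g z))\<^sup>2)"
  proof (rule Bochner_Integration.integrable_bound)
    show "integrable circle (\<lambda>z. 2 * (cmod (f z))\<^sup>2 + 2 * (cmod (g z))\<^sup>2)"
      using assms by (auto simp: square_integrable_def)
    show "(\<lambda>z. (cmod (f z + g z))\<^sup>2) \<in> borel_measurable circle"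
      using m by measurable
    have "(cmod (a + b))\<^sup>2 \<le> 2 * (cmod a)\<^sup>2 + 2 * (cmod b)\<^sup>2" for a b :: complex
    proof -
      have "(cmod (a + b))\<^sup>2 \<le> (cmod a + cmod b)\<^sup>2"
        by (intro power_mono norm_triangle_ineq) auto
      also have "\<dots> \<le> 2 * (cmod a)\<^sup>2 + 2 * (cmod b)\<^sup>2"
        using sum_squares_bound[of "cmod a" "cmod b"] by (simp add: power2_sum)
      finally show ?thesis .
    qed
    then show "AE z in circle. norm ((cmod (f z + g z))\<^sup>2)
        \<le> norm (2 * (cmod (f z))\<^sup>2 + 2 * (cmod (g z))\<^sup>2)"
      by simp
  qed
qed

lemma square_integrable_uminus: "square_integrable f \<Longrightarrow> square_integrable (\<lambda>z. - f z)"
  using square_integrable_cmult[of f "-1"] by simp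

lemma square_integrable_diff:
  "square_integrable f \<Longrightarrow> square_integrable g \<Longrightarrow> square_integrable (\<lambda>z. f z - g z)"
  using square_integrable_add[of f "\<lambda>z. - g z"] square_integrable_uminus[of g] by simp

lemma L2_rel_eqI: "square_integrable f \<Longrightarrow> f = g \<Longrightarrow> L2_rel f g"
  by (simp add: L2_rel_def)

lift_definition scaleC :: "complex \<Rightarrow> L2 \<Rightarrow> L2" is "\<lambda>c f z. c * f z"
  by (auto simp: L2_rel_def square_integrable_cmult)

text \<open>The complex inner product, linear in its first argument.\<close>

lift_definition cinner :: "L2 \<Rightarrow> L2 \<Rightarrow> complex" is "\<lambda>f g. LINT z|circle. f z * cnj (g z)"
proof -
  fix f f' g g'
  assume "L2_rel f f'" "L2_rel g g'"
  then have "square_integrable f" "square_integrable f'" "AE z in circle. f z = f' z"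
    and "square_integrable g" "square_integrable g'" "AE z in circle. g z = g' z"
    by (auto simp: L2_rel_def)
  then show "(LINT z|circle. f z * cnj (g z)) = (LINT z|circle. f' z * cnj (g' z))"
    by (intro integral_cong_AE borel_measurable_integrable square_integrable_times
          square_integrable_cnj) auto
qed

instantiation L2 :: real_inner
begin

lift_definition zero_L2 :: L2 is "\<lambda>_. 0"
  by (simp add: L2_rel_def)

lift_definition plus_L2 :: "L2 \<Rightarrow> L2 \<Rightarrow> L2" is "\<lambda>f g z. f z + g z"
  by (auto simp: L2_rel_def square_integrable_add)

lift_definition uminus_L2 :: "L2 \<Rightarrow> L2" is "\<lambda>f z. - f z"
  by (auto simp: L2_rel_def square_integrable_uminus)

lift_definition minus_L2 :: "L2 \<Rightarrow> L2 \<Rightarrow> L2" is "\<lambda>f g z. f z - g z"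
  by (auto simp: L2_rel_def square_integrable_diff)

definition scaleR_L2 :: "real \<Rightarrow> L2 \<Rightarrow> L2" where
  "scaleR_L2 r = scaleC (of_real r)"

definition inner_L2 :: "L2 \<Rightarrow> L2 \<Rightarrow> real" where
  "inner_L2 f g = Re (cinner f g)"

definition norm_L2 :: "L2 \<Rightarrow> real" where
  "norm_L2 f = sqrt (inner f f)"

definition sgn_L2 :: "L2 \<Rightarrow> L2" where
  "sgn_L2 f = inverse (norm f) *\<^sub>R f"

definition dist_L2 :: "L2 \<Rightarrow> L2 \<Rightarrow> real" where
  "dist_L2 f g = norm (f - g)"

definition uniformity_L2 :: "(L2 \<times> L2) filter" where
  "uniformity_L2 = (INF e\<in>{0<..}. principal {(x, y). dist x y < e})"

definition open_L2 :: "L2 set \<Rightarrow> bool" where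
  "open_L2 U \<longleftrightarrow> (\<forall>x\<in>U. eventually (\<lambda>(x', y). x' = x \<longrightarrow> y \<in> U) uniformity)"

instance
proof
  fix f g h :: L2 and r s :: real
  show "f + g + h = f + (g + h)"
    by transfer (auto simp: L2_rel_def square_integrable_add add.assoc)
  show "f + g = g + f"
    by transfer (auto simp: L2_rel_def square_integrable_add add.commute)
  show "0 + f = f"
    by transfer (auto simp: L2_rel_def)
  show "- f + f = 0"
    by transfer (auto simp: L2_rel_def)
  show "f - g = f + - g"
    by transfer (auto simp: L2_rel_def square_integrable_diff)
  show "r *\<^sub>R (f + g) = r *\<^sub>R f + r *\<^sub>R g"
    unfolding scaleR_L2_def
    by transfer (rule L2_rel_eqI, auto simp: L2_rel_def distrib_left
        intro!: square_integrable_add square_integrable_cmult)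
  show "(r + s) *\<^sub>R f = r *\<^sub>R f + s *\<^sub>R f"
    unfolding scaleR_L2_def
    by transfer (rule L2_rel_eqI, auto simp: L2_rel_def distrib_right
        intro!: square_integrable_add square_integrable_cmult)
  show "r *\<^sub>R s *\<^sub>R f = (r * s) *\<^sub>R f"
    unfolding scaleR_L2_def
    by transfer (rule L2_rel_eqI, auto simp: L2_rel_def mult.assoc intro!: square_integrable_cmult)
  show "1 *\<^sub>R f = f"
    unfolding scaleR_L2_def by transfer (auto simp: L2_rel_def)
  show "sgn f = inverse (norm f) *\<^sub>R f"
    by (rule sgn_L2_def)
  show "dist f g = norm (f - g)"
    by (rule dist_L2_def)
  show "uniformity = (INF e\<in>{0<..}. principal {(x :: L2, y). dist x y < e})"
    by (rule uniformity_L2_def)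
  show "open U \<longleftrightarrow> (\<forall>x\<in>U. eventually (\<lambda>(x', y). x' = x \<longrightarrow> y \<in> U) uniformity)" for U :: "L2 set"
    by (rule open_L2_def)
  show "inner f g = inner g f"
    unfolding inner_L2_def
  proof transfer
    fix f g assume "L2_rel f f" "L2_rel g g"
    have "(LINT z|circle. f z * cnj (g z)) = (LINT z|circle. cnj (g z * cnj (f z)))"
      by (simp add: mult.commute)
    also have "\<dots> = cnj (LINT z|circle. g z * cnj (f z))"
      by (rule Bochner_Integration.integral_cnj)
    finally show "Re (LINT z|circle. f z * cnj (g z)) = Re (LINT z|circle. g z * cnj (f z))"
      by simp
  qed
  show "inner (f + g) h = inner f h + inner g h"
    unfolding inner_L2_def
  proof transfer
    fix f g h assume "L2_rel f f" "L2_rel g g" "L2_rel h h"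
    then have "(LINT z|circle. (f z + g z) * cnj (h z))
        = (LINT z|circle. f z * cnj (h z)) + (LINT z|circle. g z * cnj (h z))"
      by (simp add: L2_rel_def distrib_right square_integrable_times square_integrable_cnj)
    then show "Re (LINT z|circle. (f z + g z) * cnj (h z))
        = Re (LINT z|circle. f z * cnj (h z)) + Re (LINT z|circle. g z * cnj (h z))"
      by simp
  qed
  show "inner (r *\<^sub>R f) g = r * inner f g"
    unfolding inner_L2_def scaleR_L2_def
    by transfer (simp add: mult.assoc)
  have inner_self: "Re (LINT z|circle. f z * cnj (f z)) = (LINT z|circle. (cmod (f z))\<^sup>2)"
    for f :: "complex \<Rightarrow> complex"
    by (simp only: complex_norm_square[symmetric] integral_complex_of_real Re_complex_of_real flip: of_real_power)
  show "0 \<le> inner f f"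
    unfolding inner_L2_def by transfer (simp only: inner_self, simp)
  show "inner f f = 0 \<longleftrightarrow> f = 0"
    unfolding inner_L2_def
  proof transfer
    fix f assume "L2_rel f f"
    then have f: "square_integrable f"
      by (simp add: L2_rel_def)
    then have "(LINT z|circle. (cmod (f z))\<^sup>2) = 0 \<longleftrightarrow> (AE z in circle. (cmod (f z))\<^sup>2 = 0)"
      by (intro integral_nonneg_eq_0_iff_AE) (auto simp: square_integrable_def)
    then show "Re (LINT z|circle. f z * cnj (f z)) = 0 \<longleftrightarrow> L2_rel f (\<lambda>_. 0)"
      using f by (simp only: inner_self) (simp add: L2_rel_def)
  qed
  show "norm f = sqrt (inner f f)"
    by (rule norm_L2_def)
qed

end

definition Linfty :: "(complex \<Rightarrow> complex) set" where
  "Linfty = {\<phi> \<in> borel_measurable circle. \<exists>C. AE z in circle. cmod (\<phi> z) \<le> C}"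

text \<open>The product \<open>\<phi> f\<close>; the value for \<open>\<phi> \<notin> L\<^sup>\<infinity>\<close> is junk.\<close>

lift_definition mult :: "(complex \<Rightarrow> complex) \<Rightarrow> L2 \<Rightarrow> L2"
  is "\<lambda>\<phi> f z. if \<phi> \<in> Linfty then \<phi> z * f z else 0"
proof -
  fix \<phi> f g assume fg: "L2_rel f g"
  show "L2_rel (\<lambda>z. if \<phi> \<in> Linfty then \<phi> z * f z else 0)
               (\<lambda>z. if \<phi> \<in> Linfty then \<phi> z * g z else 0)"
  proof (cases "\<phi> \<in> Linfty")
    case True
    then obtain C where C: "\<phi> \<in> borel_measurable circle" "AE z in circle. cmod (\<phi> z) \<le> C"
      by (auto simp: Linfty_def)
    have "square_integrable (\<lambda>z. \<phi> z * f z)" "square_integrable (\<lambda>z. \<phi> z * g z)"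
      using fg by (auto simp: L2_rel_def intro: square_integrable_bounded_times[OF C])
    with fg True show ?thesis
      by (auto simp: L2_rel_def)
  qed (simp add: L2_rel_def)
qed

lift_definition J :: "L2 \<Rightarrow> L2" is "\<lambda>f z. f (cnj z)"
proof -
  have si: "square_integrable (\<lambda>z. f (cnj z))" if "square_integrable f" for f
  proof -
    have "integrable (distr circle circle cnj) (\<lambda>z. (cmod (f z))\<^sup>2)"
      using that by (simp add: distr_circle_cnj square_integrable_def)
    moreover have "f \<in> borel_measurable circle"
      using that by (simp add: square_integrable_def)
    ultimately show ?thesis
      by (auto simp: square_integrable_def dest: integrable_distr[OF cnj_measurable_circle]
          intro: measurable_compose[OF cnj_measurable_circle])
  qed
  have ae: "AE z in circle. f (cnj z) = g (cnj z)" if "AE z in circle. f z = g z" for f g :: "complex \<Rightarrow> complex"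
  proof -
    have "AE z in distr circle circle cnj. f z = g z"
      unfolding distr_circle_cnj by (rule that)
    then show ?thesis
      by (rule AE_distrD[OF cnj_measurable_circle])
  qed
  fix f g assume "L2_rel f g"
  then show "L2_rel (\<lambda>z. f (cnj z)) (\<lambda>z. g (cnj z))"
    by (auto simp: L2_rel_def si ae)
qed

section \<open>Operators on subspaces\<close>

text \<open>Operators on a subspace \<open>H\<close> are functions on \<open>L2\<close> of which only the values on \<open>H\<close> matter.\<close>

definition bounded_operators :: "L2 set \<Rightarrow> (L2 \<Rightarrow> L2) set" where
  "bounded_operators H = {A. (\<forall>f\<in>H. A f \<in> H) \<and>
     (\<forall>f\<in>H. \<forall>g\<in>H. A (f + g) = A f + A g) \<and>
     (\<forall>c. \<forall>f\<in>H. A (scaleC c f) = scaleC c (A f)) \<and>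
     (\<exists>C. \<forall>f\<in>H. norm (A f) \<le> C * norm f)}"

text \<open>This is \<^const>\<open>onorm\<close> relative to \<open>H\<close>.\<close>

definition op_norm :: "L2 set \<Rightarrow> (L2 \<Rightarrow> L2) \<Rightarrow> real" where
  "op_norm H A = (SUP f\<in>H. norm (A f) / norm f)"

definition ominus :: "L2 set \<Rightarrow> L2 set \<Rightarrow> L2 set"  (infixl "\<ominus>" 65) where
  "H \<ominus> K = {f \<in> H. \<forall>g\<in>K. cinner f g = 0}"

definition proj :: "L2 set \<Rightarrow> L2 \<Rightarrow> L2" where
  "proj H f = (THE g. g \<in> H \<and> (\<forall>h\<in>H. cinner (f - g) h = 0))"

definition adj :: "L2 set \<Rightarrow> (L2 \<Rightarrow> L2) \<Rightarrow> L2 \<Rightarrow> L2" where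
  "adj H A g = (THE h. h \<in> H \<and> (\<forall>f\<in>H. cinner (A f) g = cinner f h))"

text \<open>\<open>A\<close> has the block matrix with rows \<open>A11, A12\<close> and \<open>A21, A22\<close> with respect to the
  orthogonal decomposition \<open>H = K \<oplus> (H \<ominus> K)\<close>.\<close>

definition has_block_matrix ::
  "L2 set \<Rightarrow> L2 set \<Rightarrow> (L2 \<Rightarrow> L2) \<Rightarrow>
   (L2 \<Rightarrow> L2) \<Rightarrow> (L2 \<Rightarrow> L2) \<Rightarrow> (L2 \<Rightarrow> L2) \<Rightarrow> (L2 \<Rightarrow> L2) \<Rightarrow> bool" where
  "has_block_matrix H K A A11 A12 A21 A22 \<longleftrightarrow>
     (\<forall>f\<in>K. \<forall>g\<in>H \<ominus> K.
        A11 f \<in> K \<and> A12 g \<in> K \<and> A21 f \<in> H \<ominus> K \<and> A22 g \<in> H \<ominus> K \<and>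
        A (f + g) = (A11 f + A12 g) + (A21 f + A22 g))"

section \<open>Hardy space, Hankel operators and model operators\<close>

lift_definition fourier_coeff :: "L2 \<Rightarrow> int \<Rightarrow> complex"
  is "\<lambda>f n. LINT z|circle. f z * z powi (- n)"
proof -
  fix f g :: "complex \<Rightarrow> complex"
  assume fg: "L2_rel f g"
  have "(LINT z|circle. f z * z powi (- n)) = (LINT z|circle. g z * z powi (- n))" for n
  proof -
    have "(\<lambda>z::complex. z powi (- n)) \<in> borel_measurable borel"
      unfolding power_int_def by measurable
    then have "(\<lambda>z::complex. z powi (- n)) \<in> borel_measurable circle"
      unfolding circle_def measurable_distr_eq1 by (rule measurable_restrict_space1)
    with fg show ?thesis
      by (intro integral_cong_AE)
         (auto simp: L2_rel_def square_integrable_def)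
  qed
  then show "(\<lambda>n. LINT z|circle. f z * z powi (- n)) = (\<lambda>n. LINT z|circle. g z * z powi (- n))"
    by (rule ext)
qed

definition H2 :: "L2 set" where
  "H2 = {f. \<forall>n<0. fourier_coeff f n = 0}"

definition Hankel :: "(complex \<Rightarrow> complex) \<Rightarrow> L2 \<Rightarrow> L2" where
  "Hankel \<phi> f = proj H2 (mult \<phi> (J f))"

definition Tz :: "L2 \<Rightarrow> L2" where
  "Tz f = mult (\<lambda>z. z) f"

definition Hinfty :: "(complex \<Rightarrow> complex) set" where
  "Hinfty = {u. u holomorphic_on ball 0 1 \<and> bounded (u ` ball 0 1)}"

definition has_radial_limit :: "(complex \<Rightarrow> complex) \<Rightarrow> complex \<Rightarrow> complex \<Rightarrow> bool" where
  "has_radial_limit u \<zeta> l \<longleftrightarrow> ((\<lambda>r. u (of_real r * \<zeta>)) \<longlongrightarrow> l) (at_left (1::real))"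

definition boundary :: "(complex \<Rightarrow> complex) \<Rightarrow> complex \<Rightarrow> complex" where
  "boundary u \<zeta> = Lim (at_left (1::real)) (\<lambda>r. u (of_real r * \<zeta>))"

definition inner_function :: "(complex \<Rightarrow> complex) \<Rightarrow> bool" where
  "inner_function u \<longleftrightarrow> u \<in> Hinfty \<and>
     (AE \<zeta> in circle. \<exists>l. has_radial_limit u \<zeta> l \<and> cmod l = 1)"

definition model_space :: "(complex \<Rightarrow> complex) \<Rightarrow> L2 set" where
  "model_space u = H2 \<ominus> mult (boundary u) ` H2"

definition model_operator :: "(complex \<Rightarrow> complex) \<Rightarrow> L2 \<Rightarrow> L2" where
  "model_operator u f = proj (model_space u) (Tz f)"

end

theory Submission
  imports Defs "HOL-Complex_Analysis.Cauchy_Integral_Formula"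
begin

text \<open>
  Write \<open>Q\<close> for the model space, \<open>P\<close> for the projection onto it, \<open>S\<close> for the shift on \<open>H\<^sup>2\<close> and
  \<open>S\<^sup>*\<close> for the backward shift, and put \<open>A = X P\<close>. The block condition on \<open>H\<^sub>\<phi>\<close> says that
  \<open>H\<^sub>\<phi> = A\<close> on \<open>H\<^sup>2\<close> (\<open>block_matrix_iff\<close>); since \<open>P\<close> is a contraction that fixes \<open>Q\<close>, the
  norms of \<open>A\<close> and \<open>X\<close> agree (\<open>op_norm_compression\<close>).

  An inner function multiplies \<open>H\<^sup>2\<close> into itself (\<open>mult_boundary_H2\<close>), and multiplication commutes
  with \<open>S\<close>. Hence \<open>Q\<close> is invariant under \<open>S\<^sup>*\<close>, so that \<open>S\<^sub>u\<^sup>* = S\<^sup>*\<close> on \<open>Q\<close> and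
  \<open>S\<^sub>u P = P S\<close>. Therefore \<open>S\<^sub>u\<^sup>* X = X S\<^sub>u\<close> is the same as \<open>S\<^sup>* A = A S\<close>. Every Hankel operator
  satisfies this relation (\<open>Hankel_Tz\<close>), and Nehari's theorem (\<open>Nehari\<close>) is the converse: a
  bounded operator \<open>A\<close> on \<open>H\<^sup>2\<close> with \<open>S\<^sup>* A = A S\<close> is a Hankel operator with a bounded symbol.

  Nehari's theorem is proved here by extending the Hankel form, one coefficient at a time. The
  matrix of \<open>A\<close> is \<open>(a\<^bsub>i+j\<^esub>)\<close> with \<open>i, j \<ge> 0\<close>. In
  \<open>one_step_extension\<close> a number \<open>a\<^bsub>-1\<^esub>\<close> is found such that the matrix \<open>(a\<^bsub>i+j-1\<^esub>)\<close> obeys the same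
  norm bound \<open>M\<close>. This is a one-dimensional case of Parrott's theorem: the new row is a functional
  that is known on \<open>S H\<^sup>2\<close>, is dominated there by a positive quadratic form, and has to be extended
  by one dimension under the same domination. Iteration produces all negative coefficients and a
  function \<open>\<phi>\<close> in \<open>L\<^sup>2\<close> (\<open>hankel_L2_symbol\<close>). The bound on the extended matrices is
  \<open>\<bar>\<integral> \<phi> p q\<bar> \<le> M \<parallel>p\<parallel> \<parallel>q\<parallel>\<close> for trigonometric polynomials \<open>p\<close> and \<open>q\<close>. By the Stone-Weierstrass
  theorem and inner regularity of arc length it makes \<open>\<phi>\<close> bounded (\<open>AE_bounded_of_polynomials\<close>).
  The case \<open>M = 0\<close> of the same criterion is uniqueness of Fourier coefficients, which gives density
  of the polynomials in \<open>H\<^sup>2\<close>.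
\<close>

section \<open>The inner product\<close>

lemma cinner_add_left: "cinner (f + g) h = cinner f h + cinner g h"
  by transfer (simp add: L2_rel_def distrib_right square_integrable_times square_integrable_cnj)

lemma cinner_scaleC_left: "cinner (scaleC c f) g = c * cinner f g"
  by transfer (simp add: mult.assoc)

lemma cinner_commute: "cinner g f = cnj (cinner f g)"
proof transfer
  fix f g assume "L2_rel f f" "L2_rel g g"
  have "(LINT z|circle. g z * cnj (f z)) = (LINT z|circle. cnj (f z * cnj (g z)))"
    by (simp add: mult.commute)
  also have "\<dots> = cnj (LINT z|circle. f z * cnj (g z))"
    by (rule Bochner_Integration.integral_cnj)
  finally show "(LINT z|circle. g z * cnj (f z)) = cnj (LINT z|circle. f z * cnj (g z))" .
qed

lemma cinner_add_right: "cinner h (f + g) = cinner h f + cinner h g"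
  using cinner_add_left[of f g h] by (metis cinner_commute complex_cnj_add)

lemma cinner_scaleC_right: "cinner g (scaleC c f) = cnj c * cinner g f"
  using cinner_scaleC_left[of c f g] by (metis cinner_commute complex_cnj_mult)

lemma scaleR_eq_scaleC: "r *\<^sub>R f = scaleC (of_real r) f"
  by (simp add: scaleR_L2_def)

lemma uminus_eq_scaleC: "- f = scaleC (-1) f"
  using scaleR_eq_scaleC[of "-1" f] by simp

lemma cinner_minus_left: "cinner (- f) g = - cinner f g"
  by (simp add: uminus_eq_scaleC cinner_scaleC_left)

lemma cinner_minus_right: "cinner g (- f) = - cinner g f"
  by (simp add: uminus_eq_scaleC cinner_scaleC_right)

lemma cinner_diff_left: "cinner (f - g) h = cinner f h - cinner g h"
  using cinner_add_left[of f "- g" h] by (simp add: cinner_minus_left)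

lemma cinner_diff_right: "cinner h (f - g) = cinner h f - cinner h g"
  using cinner_add_right[of h f "- g"] by (simp add: cinner_minus_right)

lemma cinner_zero_left [simp]: "cinner 0 f = 0"
  using cinner_diff_left[of 0 0 f] by simp

lemma cinner_zero_right [simp]: "cinner f 0 = 0"
  using cinner_diff_right[of f 0 0] by simp

lemmas cinner_simps = cinner_add_left cinner_add_right cinner_diff_left cinner_diff_right
  cinner_scaleC_left cinner_scaleC_right

lemma cinner_self: "cinner f f = of_real ((norm f)\<^sup>2)"
proof -
  have "Im (cinner f f) = 0"
    using cinner_commute[of f f] by (metis complex_is_Real_iff Reals_cnj_iff)
  moreover have "Re (cinner f f) = (norm f)\<^sup>2"
    by (simp add: power2_norm_eq_inner inner_L2_def)
  ultimately show ?thesis by (simp add: complex_eq_iff)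
qed

lemma scaleC_scaleC: "scaleC c (scaleC d f) = scaleC (c * d) f"
  by transfer (auto intro!: L2_rel_eqI square_integrable_cmult simp: L2_rel_def mult.assoc)

lemma scaleC_add: "scaleC c (f + g) = scaleC c f + scaleC c g"
  by transfer (auto intro!: L2_rel_eqI square_integrable_cmult square_integrable_add
      simp: L2_rel_def algebra_simps)

lemma scaleC_add_left: "scaleC (c + d) f = scaleC c f + scaleC d f"
  by transfer (auto intro!: L2_rel_eqI square_integrable_cmult square_integrable_add
      simp: L2_rel_def algebra_simps)

lemma scaleC_one [simp]: "scaleC 1 f = f"
  by transfer (auto simp: L2_rel_def)

lemma scaleC_zero [simp]: "scaleC 0 f = 0" "scaleC c 0 = 0"
  by (transfer, simp add: L2_rel_def)+

lemma scaleC_minus_right: "scaleC c (- f) = - scaleC c f"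
  by (simp add: uminus_eq_scaleC scaleC_scaleC mult.commute)

lemma scaleC_diff: "scaleC c (f - g) = scaleC c f - scaleC c g"
  using scaleC_add[of c f "- g"] by (simp add: scaleC_minus_right)

lemma norm_scaleC: "norm (scaleC c f) = cmod c * norm f"
proof -
  have "complex_of_real ((norm (scaleC c f))\<^sup>2) = of_real ((cmod c * norm f)\<^sup>2)"
    unfolding power_mult_distrib of_real_mult cinner_self[symmetric] complex_norm_square
    by (simp add: cinner_simps mult_ac)
  then have "(norm (scaleC c f))\<^sup>2 = (cmod c * norm f)\<^sup>2"
    by (rule of_real_eq_iff[THEN iffD1])
  then show ?thesis
    by (simp add: power2_eq_iff_nonneg)
qed

lemma norm_eq_cinner: "norm f = norm g \<longleftrightarrow> cinner f f = cinner g g"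
  by (simp add: cinner_self power2_eq_iff_nonneg flip: of_real_power)

text \<open>The real Cauchy-Schwarz inequality suffices after a rotation of the first argument that
  makes the inner product a nonnegative number.\<close>

lemma cinner_Cauchy_Schwarz: "cmod (cinner f g) \<le> norm f * norm g"
proof (cases "cinner f g = 0")
  case False
  define c where "c = cnj (sgn (cinner f g))"
  have c: "cmod c = 1" using False by (simp add: c_def norm_sgn)
  have "c * cinner f g = of_real (cmod (cinner f g))"
    using False complex_norm_square[of "cinner f g"] unfolding c_def sgn_eq
    by (simp add: field_simps power2_eq_square)
  then have "cmod (cinner f g) = inner (scaleC c f) g"
    by (simp add: inner_L2_def cinner_simps)
  also have "\<dots> \<le> norm (scaleC c f) * norm g"
    by (rule norm_cauchy_schwarz)
  finally show ?thesis by (simp add: norm_scaleC c)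
qed simp

lemma norm_add_orthogonal:
  assumes "cinner f g = 0"
  shows "(norm (f + g))\<^sup>2 = (norm f)\<^sup>2 + (norm g)\<^sup>2"
proof -
  have "complex_of_real ((norm (f + g))\<^sup>2) = of_real ((norm f)\<^sup>2 + (norm g)\<^sup>2)"
    using assms cinner_commute[of f g]
    by (simp only: cinner_self[symmetric] of_real_add) (simp add: cinner_simps)
  then show ?thesis by (rule of_real_eq_iff[THEN iffD1])
qed

lemma bounded_linear_cinner_left: "bounded_linear (\<lambda>f. cinner f g)"
  by (rule bounded_linear_intro[where K="norm g"])
    (auto simp: cinner_simps scaleR_eq_scaleC scaleR_conv_of_real cinner_Cauchy_Schwarz)

lemma continuous_on_cinner_left [continuous_intros]: "continuous_on S (\<lambda>f. cinner f g)"
  by (rule linear_continuous_on[OF bounded_linear_cinner_left])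

lemma L2_rel_refl [simp]: "L2_rel f f \<longleftrightarrow> square_integrable f"
  by (simp add: L2_rel_def)

lemma L2_representative:
  obtains f where "square_integrable f" "F = abs_L2 f"
  using Quotient_rep_reflp[OF Quotient_L2] Quotient_abs_rep[OF Quotient_L2] by (metis L2_rel_refl)

lemma cinner_abs_L2:
  "square_integrable f \<Longrightarrow> square_integrable g \<Longrightarrow>
    cinner (abs_L2 f) (abs_L2 g) = (LINT z|circle. f z * cnj (g z))"
  by (simp add: cinner.abs_eq)

lemma norm_abs_L2:
  assumes "square_integrable f"
  shows "(norm (abs_L2 f))\<^sup>2 = (LINT z|circle. (cmod (f z))\<^sup>2)"
proof -
  have "complex_of_real ((norm (abs_L2 f))\<^sup>2) = (LINT z|circle. of_real ((cmod (f z))\<^sup>2))"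
    using assms by (simp only: cinner_self[symmetric] cinner_abs_L2 complex_norm_square)
  then show ?thesis
    by (simp only: integral_complex_of_real of_real_eq_iff)
qed

section \<open>Multiplication by bounded functions, and the flip\<close>

lemma borel_measurable_circleI: "f \<in> borel_measurable borel \<Longrightarrow> f \<in> borel_measurable circle"
  unfolding measurable_cong_sets[OF sets_circle refl] by (rule measurable_restrict_space1)

lemma continuous_bounded_on_circle:
  fixes g :: "complex \<Rightarrow> 'b::real_normed_vector"
  assumes "continuous_on UNIV g"
  obtains B where "\<And>z. cmod z = 1 \<Longrightarrow> norm (g z) \<le> B"
proof -
  have "bounded (g ` sphere 0 1)"
    by (intro compact_imp_bounded compact_continuous_image compact_sphere
        continuous_on_subset[OF assms]) auto
  then obtain B where "\<forall>z\<in>sphere 0 1. norm (g z) \<le> B"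
    unfolding bounded_iff by blast
  then show ?thesis by (intro that[of B]) simp
qed

lemma continuous_in_Linfty:
  assumes "continuous_on UNIV \<psi>" shows "\<psi> \<in> Linfty"
proof -
  obtain C where "\<And>z. cmod z = 1 \<Longrightarrow> cmod (\<psi> z) \<le> C"
    using continuous_bounded_on_circle[OF assms] by blast
  then have "AE z in circle. cmod (\<psi> z) \<le> C" by (intro AE_I2) simp
  moreover have "\<psi> \<in> borel_measurable circle"
    by (intro borel_measurable_circleI borel_measurable_continuous_onI assms)
  ultimately show ?thesis by (auto simp: Linfty_def)
qed

lemma Linfty_continuous [simp]:
  "(\<lambda>z. z) \<in> Linfty" "cnj \<in> Linfty" "(\<lambda>z. z ^ n) \<in> Linfty" "(\<lambda>z. cnj z ^ n) \<in> Linfty"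
  "poly p \<in> Linfty" "(\<lambda>z. poly p (cnj z)) \<in> Linfty" "(\<lambda>_. c) \<in> Linfty"
  by (auto intro!: continuous_in_Linfty continuous_intros)

lemma Linfty_square_integrable:
  "\<phi> \<in> Linfty \<Longrightarrow> square_integrable f \<Longrightarrow> square_integrable (\<lambda>z. \<phi> z * f z)"
  by (auto simp: Linfty_def intro: square_integrable_bounded_times)

lemma Linfty_mult: "\<phi> \<in> Linfty \<Longrightarrow> \<psi> \<in> Linfty \<Longrightarrow> (\<lambda>z. \<phi> z * \<psi> z) \<in> Linfty"
proof -
  assume "\<phi> \<in> Linfty" "\<psi> \<in> Linfty"
  then obtain C D where *: "\<phi> \<in> borel_measurable circle" "\<psi> \<in> borel_measurable circle"
    "AE z in circle. cmod (\<phi> z) \<le> C" "AE z in circle. cmod (\<psi> z) \<le> D"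
    by (auto simp: Linfty_def)
  from *(3,4) have "AE z in circle. cmod (\<phi> z * \<psi> z) \<le> C * D"
    by eventually_elim (auto simp: norm_mult intro: mult_mono' order_trans[OF norm_ge_zero])
  then show ?thesis using *(1,2) by (auto simp: Linfty_def)
qed

lemma Linfty_cnj: "\<phi> \<in> Linfty \<Longrightarrow> (\<lambda>z. cnj (\<phi> z)) \<in> Linfty"
  by (auto simp: Linfty_def
      intro!: measurable_compose[OF _ borel_measurable_continuous_onI[of cnj]] continuous_intros)

lemma square_integrable_mult:
  "square_integrable f \<Longrightarrow> square_integrable (\<lambda>z. if \<phi> \<in> Linfty then \<phi> z * f z else 0)"
  by (cases "\<phi> \<in> Linfty") (simp_all add: Linfty_square_integrable)

lemma mult_abs_L2:
  "\<phi> \<in> Linfty \<Longrightarrow> square_integrable f \<Longrightarrow> mult \<phi> (abs_L2 f) = abs_L2 (\<lambda>z. \<phi> z * f z)"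
  by (simp add: mult.abs_eq)

lemma mult_add: "mult \<phi> (f + g) = mult \<phi> f + mult \<phi> g"
  by transfer (auto intro!: L2_rel_eqI square_integrable_add square_integrable_mult
      simp: L2_rel_def algebra_simps)

lemma mult_scaleC: "mult \<phi> (scaleC c f) = scaleC c (mult \<phi> f)"
  by transfer (auto intro!: L2_rel_eqI square_integrable_cmult square_integrable_mult
      simp: L2_rel_def algebra_simps)

lemma mult_diff: "mult \<phi> (f - g) = mult \<phi> f - mult \<phi> g"
  using mult_add[of \<phi> f "scaleC (-1) g"] mult_scaleC[of \<phi> "-1" g]
  by (simp add: uminus_eq_scaleC[symmetric])

lemma mult_mult:
  "\<phi> \<in> Linfty \<Longrightarrow> \<psi> \<in> Linfty \<Longrightarrow> mult \<phi> (mult \<psi> f) = mult (\<lambda>z. \<phi> z * \<psi> z) f"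
  by transfer (auto intro!: L2_rel_eqI Linfty_square_integrable
      simp: L2_rel_def Linfty_mult mult.assoc)

lemma mult_commute: "mult \<phi> (mult \<psi> f) = mult \<psi> (mult \<phi> f)"
  by transfer (auto intro!: L2_rel_eqI square_integrable_mult simp: L2_rel_def algebra_simps)

lemma mult_cong:
  assumes "\<phi> \<in> Linfty" "\<psi> \<in> Linfty" "\<And>z. cmod z = 1 \<Longrightarrow> \<phi> z = \<psi> z"
  shows "mult \<phi> f = mult \<psi> f"
  using assms by transfer (auto intro!: Linfty_square_integrable AE_I2 simp: L2_rel_def)

lemma cinner_mult_left:
  "\<phi> \<in> Linfty \<Longrightarrow> cinner (mult \<phi> f) g = cinner f (mult (\<lambda>z. cnj (\<phi> z)) g)"
  by transfer (simp add: Linfty_cnj mult_ac)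

lemma mult_bounded:
  assumes "\<phi> \<in> Linfty" obtains C where "\<And>f. norm (mult \<phi> f) \<le> C * norm f"
proof -
  obtain C where \<phi>: "\<phi> \<in> borel_measurable circle" and C: "AE z in circle. cmod (\<phi> z) \<le> C"
    using assms by (auto simp: Linfty_def)
  have "(norm (mult \<phi> F))\<^sup>2 \<le> (\<bar>C\<bar> * norm F)\<^sup>2" for F
  proof -
    obtain f where f: "square_integrable f" and F: "F = abs_L2 f"
      by (rule L2_representative)
    have "(LINT z|circle. (cmod (\<phi> z * f z))\<^sup>2) \<le> (LINT z|circle. \<bar>C\<bar>\<^sup>2 * (cmod (f z))\<^sup>2)"
    proof (rule integral_mono_AE)
      show "integrable circle (\<lambda>z. (cmod (\<phi> z * f z))\<^sup>2)"
        using Linfty_square_integrable[OF assms f] by (simp add: square_integrable_def)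
      show "integrable circle (\<lambda>z. \<bar>C\<bar>\<^sup>2 * (cmod (f z))\<^sup>2)"
        using f by (simp add: square_integrable_def)
      show "AE z in circle. (cmod (\<phi> z * f z))\<^sup>2 \<le> \<bar>C\<bar>\<^sup>2 * (cmod (f z))\<^sup>2"
        using C by eventually_elim
          (auto simp: norm_mult power_mult_distrib intro!: mult_right_mono power_mono)
    qed
    then show ?thesis
      using f assms by (simp add: F mult_abs_L2 norm_abs_L2 Linfty_square_integrable power_mult_distrib)
  qed
  then have "norm (mult \<phi> f) \<le> \<bar>C\<bar> * norm f" for f
    by (rule power2_le_imp_le) auto
  then show ?thesis by (rule that)
qed

lemma mult_one: "mult (\<lambda>_. 1) f = f"
  by transfer (simp add: L2_rel_def)

lemma norm_mult_unimodular:
  assumes "\<phi> \<in> Linfty" "\<And>z. cmod z = 1 \<Longrightarrow> cmod (\<phi> z) = 1"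
  shows "norm (mult \<phi> f) = norm f"
proof -
  have "cinner (mult \<phi> f) (mult \<phi> f) = cinner f (mult (\<lambda>z. cnj (\<phi> z) * \<phi> z) f)"
    using assms(1) by (simp add: cinner_mult_left mult_mult Linfty_cnj)
  also have "mult (\<lambda>z. cnj (\<phi> z) * \<phi> z) f = mult (\<lambda>_. 1) f"
    using assms by (intro mult_cong Linfty_mult Linfty_cnj Linfty_continuous)
      (auto simp: mult.commute complex_norm_square[symmetric])
  also have "\<dots> = f"
    by (rule mult_one)
  finally show ?thesis by (simp add: norm_eq_cinner)
qed

lemma square_integrable_flip:
  assumes "square_integrable f" shows "square_integrable (\<lambda>z. f (cnj z))"
    and integral_flip: "(LINT z|circle. (cmod (f (cnj z)))\<^sup>2) = (LINT z|circle. (cmod (f z))\<^sup>2)"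
proof -
  have f: "f \<in> borel_measurable circle" "integrable circle (\<lambda>z. (cmod (f z))\<^sup>2)"
    using assms by (auto simp: square_integrable_def)
  have "integrable (distr circle circle cnj) (\<lambda>z. (cmod (f z))\<^sup>2)"
    using f by (simp add: distr_circle_cnj)
  with f show "square_integrable (\<lambda>z. f (cnj z))"
    by (auto simp: square_integrable_def dest: integrable_distr[OF cnj_measurable_circle]
        intro: measurable_compose[OF cnj_measurable_circle])
  have "(LINT z|distr circle circle cnj. (cmod (f z))\<^sup>2) = (LINT z|circle. (cmod (f (cnj z)))\<^sup>2)"
    using f by (intro integral_distr cnj_measurable_circle) auto
  then show "(LINT z|circle. (cmod (f (cnj z)))\<^sup>2) = (LINT z|circle. (cmod (f z))\<^sup>2)"
    by (simp add: distr_circle_cnj)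
qed

lemma J_abs_L2: "square_integrable f \<Longrightarrow> J (abs_L2 f) = abs_L2 (\<lambda>z. f (cnj z))"
  by (simp add: J.abs_eq)

lemma norm_J: "norm (J F) = norm F"
proof -
  obtain f where f: "square_integrable f" and F: "F = abs_L2 f"
    by (rule L2_representative)
  have "(norm (J F))\<^sup>2 = (norm F)\<^sup>2"
    using f by (simp add: F J_abs_L2 norm_abs_L2 square_integrable_flip integral_flip)
  then show ?thesis by (simp add: power2_eq_iff_nonneg)
qed

lemma J_add: "J (f + g) = J f + J g"
  by transfer (auto simp: L2_rel_def intro!: L2_rel_eqI square_integrable_add square_integrable_flip)

lemma J_scaleC: "J (scaleC c f) = scaleC c (J f)"
  by transfer (auto simp: L2_rel_def intro!: L2_rel_eqI square_integrable_cmult square_integrable_flip)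

lemma J_mult:
  assumes "\<phi> \<in> Linfty" "(\<lambda>z. \<phi> (cnj z)) \<in> Linfty"
  shows "J (mult \<phi> f) = mult (\<lambda>z. \<phi> (cnj z)) (J f)"
  using assms by transfer (auto simp: L2_rel_def Linfty_square_integrable square_integrable_flip)

section \<open>Completeness of the space of square integrable functions\<close>

definition unit_fun :: L2 where "unit_fun = abs_L2 (\<lambda>_. 1)"

lemma square_integrable_const_one: "square_integrable (\<lambda>_. 1)"
  using finite_measure_circle
  by (auto simp: square_integrable_def finite_measure.integrable_const)

lemma norm_unit_fun [simp]: "norm unit_fun = 1"
proof -
  have "(norm unit_fun)\<^sup>2 = 1"
    using emeasure_space_circle
    by (simp add: unit_fun_def norm_abs_L2 square_integrable_const_one measure_def)
  then show ?thesis using power2_eq_iff_nonneg[of "norm unit_fun" 1] by simp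
qed

lemma cinner_unit_fun [simp]: "cinner unit_fun unit_fun = 1"
  by (simp add: cinner_self)

lemma integral_cmod_le_norm:
  assumes "square_integrable f"
  shows "integrable circle f" "(LINT z|circle. cmod (f z)) \<le> norm (abs_L2 f)"
proof -
  show "integrable circle f"
    using square_integrable_times[OF assms square_integrable_const_one] by simp
  have f: "f \<in> borel_measurable circle" "integrable circle (\<lambda>z. (cmod (f z))\<^sup>2)"
    using assms by (auto simp: square_integrable_def)
  have a: "square_integrable (\<lambda>z. of_real (cmod (f z)))"
    using f by (auto simp: square_integrable_def)
  have "of_real (LINT z|circle. cmod (f z)) = cinner (abs_L2 (\<lambda>z. of_real (cmod (f z)))) unit_fun"
    using a by (simp add: unit_fun_def square_integrable_const_one cinner_abs_L2)
  then have "(LINT z|circle. cmod (f z)) = cmod \<dots>"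
    by (metis Bochner_Integration.integral_nonneg norm_ge_zero norm_of_real abs_of_nonneg)
  also have "\<dots> \<le> norm (abs_L2 (\<lambda>z. of_real (cmod (f z)))) * norm unit_fun"
    by (rule cinner_Cauchy_Schwarz)
  also have "norm (abs_L2 (\<lambda>z. of_real (cmod (f z)))) = norm (abs_L2 f)"
  proof -
    have "(norm (abs_L2 (\<lambda>z. of_real (cmod (f z)))))\<^sup>2 = (norm (abs_L2 f))\<^sup>2"
      using a assms by (simp add: norm_abs_L2)
    then show ?thesis by (simp add: power2_eq_iff_nonneg)
  qed
  finally show "(LINT z|circle. cmod (f z)) \<le> norm (abs_L2 f)" by simp
qed

text \<open>A subsequence with summable steps converges almost everywhere, and
  Fatou's lemma turns the pointwise limit into a limit in norm.\<close>

instance L2 :: complete_space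
proof
  fix X :: "nat \<Rightarrow> L2" assume "Cauchy X"
  have "\<forall>n. \<exists>N. \<forall>k\<ge>N. \<forall>l\<ge>N. dist (X k) (X l) < (1/2)^n"
    using \<open>Cauchy X\<close> by (auto simp: Cauchy_def)
  then obtain N where N: "\<And>n k l. k \<ge> N n \<Longrightarrow> l \<ge> N n \<Longrightarrow> dist (X k) (X l) < (1/2)^n"
    by metis
  \<comment> \<open>Partial sums make the chosen indices monotone while staying above each \<open>N n\<close>.\<close>
  define s where "s n = (\<Sum>i\<le>n. N i)" for n
  have s: "s n \<ge> N n" "s n \<le> s (Suc n)" for n by (auto simp: s_def member_le_sum)
  have smono: "s n \<le> s m" if "n \<le> m" for n m
    using that s(2) by (rule lift_Suc_mono_le[rotated])
  have "\<exists>f. square_integrable f \<and> X (s n) = abs_L2 f" for n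
    by (metis L2_representative)
  then obtain f where f: "\<And>n. square_integrable (f n)" "\<And>n. X (s n) = abs_L2 (f n)"
    by metis
  have diff: "abs_L2 (\<lambda>z. f m z - f n z) = X (s m) - X (s n)" for m n
    using f by (simp add: minus_L2.abs_eq)
  have meas: "f n \<in> borel_measurable circle" for n
    using f by (simp add: square_integrable_def)
  have step: "(LINT z|circle. cmod (f (Suc n) z - f n z)) \<le> (1/2)^n" for n
  proof -
    have "(LINT z|circle. cmod (f (Suc n) z - f n z)) \<le> norm (X (s (Suc n)) - X (s n))"
      using integral_cmod_le_norm(2)[OF square_integrable_diff[OF f(1)[of "Suc n"] f(1)[of n]]]
      by (simp add: diff)
    also have "\<dots> < (1/2)^n"
      using N[of n "s (Suc n)" "s n"] s[of n] by (simp add: dist_norm)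
    finally show ?thesis by simp
  qed
  have "(\<integral>\<^sup>+z. (\<Sum>n. ennreal (cmod (f (Suc n) z - f n z))) \<partial>circle)
      = (\<Sum>n. \<integral>\<^sup>+z. ennreal (cmod (f (Suc n) z - f n z)) \<partial>circle)"
    using meas by (intro nn_integral_suminf) auto
  also have "\<dots> = (\<Sum>n. ennreal (LINT z|circle. cmod (f (Suc n) z - f n z)))"
    by (intro suminf_cong nn_integral_eq_integral integrable_norm
        integral_cmod_le_norm(1) square_integrable_diff f) auto
  also have "\<dots> \<le> (\<Sum>n. ennreal ((1/2)^n))"
    by (intro suminf_le ennreal_leI step) auto
  also have "\<dots> < \<infinity>"
    by (subst suminf_ennreal2) (auto simp: summable_geometric)
  finally have "AE z in circle. (\<Sum>n. ennreal (cmod (f (Suc n) z - f n z))) \<noteq> \<infinity>"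
    using meas by (intro nn_integral_PInf_AE) auto
  then have conv: "AE z in circle. convergent (\<lambda>n. f n z)"
  proof eventually_elim
    fix z assume "(\<Sum>n. ennreal (cmod (f (Suc n) z - f n z))) \<noteq> \<infinity>"
    then have "summable (\<lambda>n. cmod (f (Suc n) z - f n z))"
      by (intro summable_suminf_not_top) auto
    then have "summable (\<lambda>n. f (Suc n) z - f n z)"
      by (rule summable_norm_cancel)
    then have "convergent (\<lambda>n. f 0 z + (\<Sum>i<n. f (Suc i) z - f i z))"
      by (intro convergent_add convergent_const) (simp add: summable_iff_convergent)
    also have "(\<lambda>n. f 0 z + (\<Sum>i<n. f (Suc i) z - f i z)) = (\<lambda>n. f n z)"
      using sum_lessThan_telescope[of "\<lambda>n. f n z"] by simp
    finally show "convergent (\<lambda>n. f n z)" .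
  qed
  define g where "g z = lim (\<lambda>n. f n z)" for z
  have g [measurable]: "g \<in> borel_measurable circle"
    unfolding g_def using meas by (rule borel_measurable_lim_metric)
  have lim: "AE z in circle. (\<lambda>n. f n z) \<longlonglongrightarrow> g z"
    using conv unfolding g_def by eventually_elim (simp add: convergent_LIMSEQ_iff)
  have close: "square_integrable (\<lambda>z. g z - f n z) \<and>
      (LINT z|circle. (cmod (g z - f n z))\<^sup>2) \<le> ((1/2)^n)\<^sup>2" for n
  proof -
    have "(\<integral>\<^sup>+z. ennreal ((cmod (g z - f n z))\<^sup>2) \<partial>circle)
        = (\<integral>\<^sup>+z. liminf (\<lambda>m. ennreal ((cmod (f m z - f n z))\<^sup>2)) \<partial>circle)"
      using lim by (intro nn_integral_cong_AE, eventually_elim)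
        (intro lim_imp_Liminf[symmetric] tendsto_intros, auto)
    also have "\<dots> \<le> liminf (\<lambda>m. \<integral>\<^sup>+z. ennreal ((cmod (f m z - f n z))\<^sup>2) \<partial>circle)"
      using meas by (intro nn_integral_liminf) auto
    also have "\<dots> \<le> ennreal (((1/2)^n)\<^sup>2)"
    proof (rule Liminf_le[OF sequentially_bot], rule eventually_sequentiallyI[of n])
      fix m assume "n \<le> m"
      have sq: "square_integrable (\<lambda>z. f m z - f n z)" by (intro square_integrable_diff f)
      have "(\<integral>\<^sup>+z. ennreal ((cmod (f m z - f n z))\<^sup>2) \<partial>circle) = ennreal ((norm (X (s m) - X (s n)))\<^sup>2)"
        using sq by (subst nn_integral_eq_integral)
          (auto simp: norm_abs_L2[OF sq, unfolded diff] square_integrable_def)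
      also have "\<dots> \<le> ennreal (((1/2)^n)\<^sup>2)"
        using N[of n "s m" "s n"] s(1)[of n] smono[OF \<open>n \<le> m\<close>]
        by (intro ennreal_leI power_mono) (auto simp: dist_norm)
      finally show "(\<integral>\<^sup>+z. ennreal ((cmod (f m z - f n z))\<^sup>2) \<partial>circle) \<le> ennreal (((1/2)^n)\<^sup>2)" .
    qed
    finally have *: "(\<integral>\<^sup>+z. ennreal ((cmod (g z - f n z))\<^sup>2) \<partial>circle) \<le> ennreal (((1/2)^n)\<^sup>2)" .
    have m: "(\<lambda>z. g z - f n z) \<in> borel_measurable circle" using g meas by simp
    have "integrable circle (\<lambda>z. (cmod (g z - f n z))\<^sup>2)"
      using * m by (intro integrableI_nonneg) (auto intro: le_less_trans)
    with * m show ?thesis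
      by (auto simp: square_integrable_def nn_integral_eq_integral)
  qed
  have gsq: "square_integrable g"
    using square_integrable_add[OF conjunct1[OF close[of 0]] f(1)[of 0]] by simp
  have dist: "dist (X (s n)) (abs_L2 g) \<le> (1/2)^n" for n
  proof -
    have "(norm (abs_L2 g - X (s n)))\<^sup>2 \<le> ((1/2)^n)\<^sup>2"
      using close[of n] gsq f by (simp add: minus_L2.abs_eq norm_abs_L2)
    then have "norm (abs_L2 g - X (s n)) \<le> (1/2)^n" by (rule power2_le_imp_le) simp
    then show ?thesis by (simp add: dist_norm norm_minus_commute)
  qed
  have "X \<longlonglongrightarrow> abs_L2 g"
  proof (rule metric_LIMSEQ_I)
    fix r :: real assume "r > 0"
    obtain n where n: "(1/2)^n < r/2"
      using real_arch_pow_inv[of "r/2" "1/2"] \<open>r > 0\<close> by auto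
    have "dist (X k) (abs_L2 g) < r" if "k \<ge> N n" for k
      using N[OF that s(1)] dist[of n] n dist_triangle[of "X k" "abs_L2 g" "X (s n)"] by linarith
    then show "\<exists>no. \<forall>k\<ge>no. dist (X k) (abs_L2 g) < r" by blast
  qed
  then show "convergent X" by (auto simp: convergent_def)
qed

section \<open>Near-minimisers and orthogonal projections\<close>

lemma norm_convex_combination:
  fixes a b :: "'a::real_inner"
  shows "(norm ((1 - t) *\<^sub>R a + t *\<^sub>R b))\<^sup>2
    = (1 - t) * (norm a)\<^sup>2 + t * (norm b)\<^sup>2 - t * (1 - t) * (norm (a - b))\<^sup>2"
  by (simp add: power2_norm_eq_inner inner_simps inner_commute algebra_simps)

text \<open>The identity for \<open>Q\<close> makes it convex with modulus \<open>D\<close>. Two points at which \<open>Q\<close> is nearly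
  minimal are therefore close in the sense of \<open>D\<close>, so the images under \<open>\<rho>\<close> of a minimising sequence
  converge, although the sequence itself need not. With the identity as \<open>\<rho>\<close> this is the
  projection theorem. With a linear functional as \<open>\<rho>\<close> the limit \<open>d\<close> is the common point of a family
  of discs that solves the extension problem for Hankel forms.\<close>

lemma minimising_point:
  fixes Q :: "'a::real_vector \<Rightarrow> real" and \<rho> :: "'a \<Rightarrow> 'b::complete_space"
  assumes "convex C" "C \<noteq> {}" and pos: "\<And>x. x \<in> C \<Longrightarrow> 0 \<le> Q x"
    and Q: "\<And>x y t. x \<in> C \<Longrightarrow> y \<in> C \<Longrightarrow>
      Q ((1 - t) *\<^sub>R x + t *\<^sub>R y) = (1 - t) * Q x + t * Q y - t * (1 - t) * D x y"
    and D: "\<And>x y. x \<in> C \<Longrightarrow> y \<in> C \<Longrightarrow> (dist (\<rho> x) (\<rho> y))\<^sup>2 \<le> D x y"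
  shows "\<exists>d\<in>closure (\<rho> ` C). \<forall>x\<in>C. (dist d (\<rho> x))\<^sup>2 + Inf (Q ` C) \<le> Q x"
proof -
  define m where "m = Inf (Q ` C)"
  have bdd: "bdd_below (Q ` C)" using pos by (auto intro: bdd_belowI[of _ 0])
  have m: "m \<le> Q x" if "x \<in> C" for x
    unfolding m_def using that bdd by (auto intro: cInf_lower)
  \<comment> \<open>The weight \<open>t\<close> stays free: \<open>t = 1/2\<close> is enough for the Cauchy property, but would lose a factor
    of 2 in the final inequality, which comes from \<open>t\<close> tending to 0.\<close>
  have key: "t * (1 - t) * (dist (\<rho> x) (\<rho> y))\<^sup>2 \<le> (1 - t) * (Q x - m) + t * (Q y - m)"
    if "x \<in> C" "y \<in> C" "0 < t" "t < 1" for x y t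
  proof -
    have "(1 - t) *\<^sub>R x + t *\<^sub>R y \<in> C"
      using that \<open>convex C\<close> by (simp add: convex_alt)
    then have "m \<le> (1 - t) * Q x + t * Q y - t * (1 - t) * D x y"
      using m Q that by metis
    moreover have "t * (1 - t) * (dist (\<rho> x) (\<rho> y))\<^sup>2 \<le> t * (1 - t) * D x y"
      using that by (intro mult_left_mono D) auto
    ultimately show ?thesis by (simp add: algebra_simps)
  qed
  have "\<exists>a\<in>C. Q a < m + 1 / Suc n" for n
    using cInf_lessD[of "Q ` C" "m + 1 / Suc n"] \<open>C \<noteq> {}\<close> by (auto simp: m_def)
  then obtain a where a: "\<And>n. a n \<in> C" "\<And>n. Q (a n) < m + 1 / Suc n"
    by metis
  have "Cauchy (\<lambda>n. \<rho> (a n))"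
  proof (rule metric_CauchyI)
    fix e :: real assume "e > 0"
    then obtain N where N: "1 / Suc N < e\<^sup>2 / 4"
      using nat_approx_posE[of "e\<^sup>2 / 4"] by auto
    have "dist (\<rho> (a k)) (\<rho> (a l)) < e" if "k \<ge> N" "l \<ge> N" for k l
    proof (rule power_less_imp_less_base[of _ 2])
      have "1 / Suc k \<le> 1 / Suc N" "1 / Suc l \<le> 1 / Suc N"
        using that by (auto simp: field_simps)
      then show "(dist (\<rho> (a k)) (\<rho> (a l)))\<^sup>2 < e\<^sup>2"
        using key[OF a(1) a(1), of "1/2" k l, simplified] a(2)[of k] a(2)[of l] N
        by (simp only: of_nat_Suc) argo
    qed (use \<open>e > 0\<close> in simp)
    then show "\<exists>N. \<forall>k\<ge>N. \<forall>l\<ge>N. dist (\<rho> (a k)) (\<rho> (a l)) < e" by blast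
  qed
  then obtain d where d: "(\<lambda>n. \<rho> (a n)) \<longlonglongrightarrow> d"
    by (auto simp: Cauchy_convergent_iff convergent_def)
  have Qlim: "(\<lambda>n. Q (a n)) \<longlonglongrightarrow> m"
  proof (rule tendsto_sandwich[of "\<lambda>_. m" _ _ "\<lambda>n. m + 1 / Suc n"])
    show "(\<lambda>n. m + 1 / Suc n) \<longlonglongrightarrow> m"
      using tendsto_add[OF tendsto_const[of m] LIMSEQ_inverse_real_of_nat]
      by (simp add: inverse_eq_divide)
  qed (use a m in \<open>auto intro!: always_eventually less_imp_le simp del: of_nat_Suc\<close>)
  have "(dist d (\<rho> x))\<^sup>2 \<le> Q x - m" if x: "x \<in> C" for x
  proof (rule field_le_mult_one_interval)
    fix s :: real assume s: "0 < s" "s < 1"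
    define t where "t = 1 - s"
    have t: "0 < t" "t < 1" "s = 1 - t" using s by (auto simp: t_def)
    have "t * (1 - t) * (dist d (\<rho> x))\<^sup>2 \<le> (1 - t) * (m - m) + t * (Q x - m)"
    proof (rule LIMSEQ_le)
      show "(\<lambda>n. t * (1 - t) * (dist (\<rho> (a n)) (\<rho> x))\<^sup>2) \<longlonglongrightarrow> t * (1 - t) * (dist d (\<rho> x))\<^sup>2"
        by (intro tendsto_intros d)
      show "(\<lambda>n. (1 - t) * (Q (a n) - m) + t * (Q x - m)) \<longlonglongrightarrow> (1 - t) * (m - m) + t * (Q x - m)"
        by (intro tendsto_intros Qlim)
    qed (use key[OF a(1) x] t in auto)
    then have "t * (s * (dist d (\<rho> x))\<^sup>2) \<le> t * (Q x - m)" using t by (simp add: mult.assoc)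
    with t show "s * (dist d (\<rho> x))\<^sup>2 \<le> Q x - m" by simp
  qed
  moreover have "d \<in> closure (\<rho> ` C)"
    using d a(1) by (auto simp: closure_sequential intro!: exI[of _ "\<lambda>n. \<rho> (a n)"])
  ultimately show ?thesis
    by (intro bexI[of _ d]) (auto simp: m_def le_diff_eq)
qed

definition csubspace :: "L2 set \<Rightarrow> bool" where
  "csubspace K \<longleftrightarrow> 0 \<in> K \<and> (\<forall>f\<in>K. \<forall>g\<in>K. f + g \<in> K) \<and> (\<forall>c. \<forall>f\<in>K. scaleC c f \<in> K)"

lemma csubspaceD:
  assumes "csubspace K"
  shows "0 \<in> K" "f \<in> K \<Longrightarrow> g \<in> K \<Longrightarrow> f + g \<in> K" "f \<in> K \<Longrightarrow> scaleC c f \<in> K"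
    "f \<in> K \<Longrightarrow> g \<in> K \<Longrightarrow> f - g \<in> K" "f \<in> K \<Longrightarrow> r *\<^sub>R f \<in> K"
  using assms by (auto simp: csubspace_def scaleR_eq_scaleC)
    (metis add_uminus_conv_diff uminus_eq_scaleC)

lemma csubspace_convex: "csubspace K \<Longrightarrow> convex K"
  by (auto simp: convex_def csubspaceD)

text \<open>The inequality of \<open>minimising_point\<close> at \<open>g + s h\<close> bounds a linear function of the real
  number \<open>s\<close> from above, so its slope \<open>inner (f - g) h\<close> vanishes. On a complex subspace this real
  orthogonality, applied to \<open>h\<close> and to \<open>\<i> h\<close>, is complex orthogonality.\<close>

lemma projection_exists:
  assumes "csubspace K" "closed K"
  obtains g where "g \<in> K" "\<And>h. h \<in> K \<Longrightarrow> cinner (f - g) h = 0"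
proof -
  note K = csubspaceD[OF assms(1)]
  define Q where "Q x = (norm (f - x))\<^sup>2" for x
  have eq: "Q ((1 - t) *\<^sub>R x + t *\<^sub>R y) = (1 - t) * Q x + t * Q y - t * (1 - t) * (norm (x - y))\<^sup>2" for x y t
  proof -
    have "f - ((1 - t) *\<^sub>R x + t *\<^sub>R y) = (1 - t) *\<^sub>R (f - x) + t *\<^sub>R (f - y)"
      by (simp add: algebra_simps)
    then show ?thesis
      unfolding Q_def by (simp add: norm_convex_combination norm_minus_commute)
  qed
  have "\<exists>g\<in>closure ((\<lambda>x. x) ` K). \<forall>x\<in>K. (dist g x)\<^sup>2 + Inf (Q ` K) \<le> Q x"
    by (rule minimising_point[where D="\<lambda>x y. (norm (x - y))\<^sup>2"])
      (use K(1) eq in \<open>auto simp: csubspace_convex assms(1) Q_def dist_norm\<close>)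
  then obtain g where "g \<in> closure K"
    and g': "\<And>x. x \<in> K \<Longrightarrow> (dist g x)\<^sup>2 + Inf (Q ` K) \<le> Q x"
    by auto
  then have g: "g \<in> K" using \<open>closed K\<close> by simp
  have re: "inner (f - g) h = 0" if h: "h \<in> K" for h
  proof (rule ccontr)
    assume ne: "inner (f - g) h \<noteq> 0"
    \<comment> \<open>The parameter at which the linear function exceeds its bound by 1.\<close>
    define s where "s = ((norm (f - g))\<^sup>2 - Inf (Q ` K) + 1) / (2 * inner (f - g) h)"
    have "(dist g (g + s *\<^sub>R h))\<^sup>2 + Inf (Q ` K) \<le> Q (g + s *\<^sub>R h)"
      by (intro g' K g h)
    also have "Q (g + s *\<^sub>R h) = (norm (f - g))\<^sup>2 - 2 * s * inner (f - g) h + (norm (s *\<^sub>R h))\<^sup>2"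
      unfolding Q_def diff_diff_eq[symmetric] power2_norm_eq_inner
      by (simp add: inner_simps inner_commute algebra_simps)
    finally have "2 * s * inner (f - g) h \<le> (norm (f - g))\<^sup>2 - Inf (Q ` K)"
      by (simp add: dist_norm)
    also have "2 * s * inner (f - g) h = (norm (f - g))\<^sup>2 - Inf (Q ` K) + 1"
      using ne by (simp add: s_def)
    finally show False by simp
  qed
  have "cinner (f - g) h = 0" if "h \<in> K" for h
    using re[OF that] re[OF K(3)[OF that, of \<i>]]
    by (simp add: inner_L2_def cinner_scaleC_right complex_eq_iff)
  with g that show ?thesis by blast
qed

lemma proj_eqI:
  assumes K: "csubspace K" and g: "g \<in> K" "\<And>h. h \<in> K \<Longrightarrow> cinner (f - g) h = 0"
  shows "proj K f = g"
  unfolding proj_def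
proof (rule the_equality)
  fix g' assume g': "g' \<in> K \<and> (\<forall>h\<in>K. cinner (f - g') h = 0)"
  then have "g' - g \<in> K" using K g by (blast intro: csubspaceD)
  then have "cinner (f - g) (g' - g) - cinner (f - g') (g' - g) = 0" using g g' by simp
  then have "cinner (g' - g) (g' - g) = 0" by (simp add: cinner_diff_left)
  then show "g' = g" by (simp add: cinner_self)
qed (use g in auto)

lemma
  assumes "csubspace K" "closed K"
  shows proj_in: "proj K f \<in> K" and proj_orth: "h \<in> K \<Longrightarrow> cinner (f - proj K f) h = 0"
    and cinner_proj: "h \<in> K \<Longrightarrow> cinner (proj K f) h = cinner f h"
proof -
  obtain g where g: "g \<in> K" "\<And>h. h \<in> K \<Longrightarrow> cinner (f - g) h = 0"
    using projection_exists[OF assms] by metis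
  have "proj K f = g" by (rule proj_eqI[OF assms(1) g])
  with g show "proj K f \<in> K" "h \<in> K \<Longrightarrow> cinner (f - proj K f) h = 0"
    "h \<in> K \<Longrightarrow> cinner (proj K f) h = cinner f h"
    by (auto simp: cinner_diff_left)
qed

lemma proj_add:
  assumes "csubspace K" "closed K" shows "proj K (f + g) = proj K f + proj K g"
  by (intro proj_eqI csubspaceD(2)[OF assms(1)] proj_in assms)
    (simp add: cinner_simps cinner_proj assms)

lemma proj_scaleC:
  assumes "csubspace K" "closed K" shows "proj K (scaleC c f) = scaleC c (proj K f)"
  by (intro proj_eqI csubspaceD(3)[OF assms(1)] proj_in assms)
    (simp add: cinner_simps cinner_proj assms)

lemma proj_ident: "csubspace K \<Longrightarrow> f \<in> K \<Longrightarrow> proj K f = f"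
  by (rule proj_eqI) auto

lemma norm_proj_le:
  assumes "csubspace K" "closed K" shows "norm (proj K f) \<le> norm f"
proof (rule power2_le_imp_le)
  have "(norm (f - proj K f + proj K f))\<^sup>2 = (norm (f - proj K f))\<^sup>2 + (norm (proj K f))\<^sup>2"
    by (intro norm_add_orthogonal proj_orth proj_in assms)
  then show "(norm (proj K f))\<^sup>2 \<le> (norm f)\<^sup>2" by simp
qed simp

section \<open>The shift and the backward shift on the Hardy space\<close>

lemma circle_integral_power: "(LINT z|circle. z ^ Suc n) = 0"
proof -
  define F where "F t = cis (real (Suc n) * t) / (\<i> * of_nat (Suc n))" for t
  have "(LINT z|circle. z ^ Suc n) = (LINT t|uniform_measure lborel {0..2*pi}. cis t ^ Suc n)"
    unfolding circle_def
    by (rule integral_distr[OF cis_measurable_circle])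
      (intro measurable_restrict_space1 borel_measurable_continuous_onI continuous_intros)
  also have "\<dots> = (LINT t|lborel. (indicator {0..2*pi} t / (2*pi)) *\<^sub>R cis t ^ Suc n)"
  proof -
    have "uniform_measure lborel {0..2*pi} = density lborel (\<lambda>t. ennreal (indicator {0..2*pi} t / (2*pi)))"
      unfolding uniform_measure_def
    proof (intro arg_cong2[where f=density] refl ext)
      fix t :: real
      have "emeasure lborel {0..2*pi} = ennreal (2*pi)" by simp
      moreover have "1 / ennreal (2*pi) = ennreal (1 / (2*pi))"
        using divide_ennreal[of 1 "2*pi"] by (simp only: ennreal_1) simp
      ultimately show "indicator {0..2*pi} t / emeasure lborel {0..2*pi} = ennreal (indicator {0..2*pi} t / (2*pi))"
        by (simp only: indicator_def) auto
    qed
    then show ?thesis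
      by (subst integral_density[symmetric])
        (auto intro!: borel_measurable_continuous_onI continuous_intros simp del: power_Suc)
  qed
  also have "\<dots> = (LINT t|lborel. (1 / (2*pi)) *\<^sub>R (indicator {0..2*pi} t *\<^sub>R cis t ^ Suc n))"
    by (simp only: scaleR_scaleR times_divide_eq_left mult_1_left)
  also have "\<dots> = (1 / (2*pi)) *\<^sub>R (LINT t|lborel. indicator {0..2*pi} t *\<^sub>R cis t ^ Suc n)"
    by (rule integral_scaleR_right)
  also have "(LINT t|lborel. indicator {0..2*pi} t *\<^sub>R cis t ^ Suc n) = F (2*pi) - F 0"
  proof (rule integral_FTC_Icc)
    fix t :: real
    show "(F has_vector_derivative cis t ^ Suc n) (at t within {0..2*pi})"
    proof -
      let ?k = "\<i> * of_nat (Suc n) :: complex"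
      have k: "?k \<noteq> 0" by (simp del: of_nat_Suc)
      have "((\<lambda>w. exp (?k * w) / ?k) has_field_derivative exp (?k * of_real t)) (at (of_real t))"
        using k by (auto intro!: derivative_eq_intros simp del: of_nat_Suc)
      then have "((\<lambda>t. exp (?k * of_real t) / ?k) has_vector_derivative exp (?k * of_real t))
          (at t within {0..2*pi})"
        by (rule has_vector_derivative_real_field)
      moreover have e: "cis (real (Suc n) * s) = exp (?k * of_real s)" for s
        by (simp only: cis_conv_exp of_real_mult of_real_of_nat_eq mult.assoc)
      moreover have "F = (\<lambda>t. exp (?k * of_real t) / ?k)"
        by (intro ext) (simp only: F_def e)
      moreover have "cis t ^ Suc n = exp (?k * of_real t)"
        by (simp only: Complex.DeMoivre e)
      ultimately show ?thesis by (simp only:)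
    qed
  qed (auto intro!: continuous_intros)
  also have "F (2*pi) = F 0"
  proof -
    have "cis (real (Suc n) * (2*pi)) = cis (2*pi) ^ Suc n" by (simp only: Complex.DeMoivre)
    also have "\<dots> = cis (real (Suc n) * 0)" by (simp only: cis_2pi mult_zero_right cis_zero power_one)
    finally show ?thesis by (simp only: F_def)
  qed
  finally show ?thesis by (simp only: diff_self scaleR_zero_right)
qed

text \<open>Orthogonality to the functions \<open>z\<^sup>-\<^sup>k\<close> with \<open>k > 0\<close> is convenient because these functions,
  as multiples of \<open>unit_fun\<close>, are moved by the adjointness rule for multiplications.\<close>

lemma H2_iff: "f \<in> H2 \<longleftrightarrow> (\<forall>k. cinner f (mult (\<lambda>z. cnj z ^ Suc k) unit_fun) = 0)"
proof -
  obtain f' where f': "square_integrable f'" "f = abs_L2 f'" by (rule L2_representative)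
  have "fourier_coeff f (- int (Suc k)) = cinner f (mult (\<lambda>z. cnj z ^ Suc k) unit_fun)" for k
  proof -
    have "fourier_coeff f (- int (Suc k)) = (LINT z|circle. f' z * z ^ Suc k)"
      using f' by (simp add: fourier_coeff.abs_eq power_int_of_nat del: of_nat_Suc)
    also have "\<dots> = cinner f (abs_L2 (\<lambda>z. cnj z ^ Suc k * 1))"
      by (simp add: f' cinner_abs_L2 Linfty_square_integrable square_integrable_const_one del: mult_1_right power_Suc)
        simp
    also have "abs_L2 (\<lambda>z. cnj z ^ Suc k * 1) = mult (\<lambda>z. cnj z ^ Suc k) unit_fun"
      unfolding unit_fun_def by (intro mult_abs_L2[symmetric] Linfty_continuous square_integrable_const_one)
    finally show ?thesis .
  qed
  then have "(\<forall>k. cinner f (mult (\<lambda>z. cnj z ^ Suc k) unit_fun) = 0)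
      \<longleftrightarrow> (\<forall>k. fourier_coeff f (- int (Suc k)) = 0)" by simp
  also have "\<dots> \<longleftrightarrow> (\<forall>n<0. fourier_coeff f n = 0)"
  proof (intro iffI allI impI)
    fix n :: int assume *: "\<forall>k. fourier_coeff f (- int (Suc k)) = 0" and "n < 0"
    then have "n = - int (Suc (nat (- n - 1)))" by simp
    then show "fourier_coeff f n = 0" using * by metis
  qed simp
  finally show ?thesis by (simp add: H2_def)
qed

lemma csubspace_H2: "csubspace H2"
  by (auto simp: csubspace_def H2_iff cinner_simps simp del: power_Suc)

lemma closed_H2: "closed H2"
proof -
  have "H2 = (\<Inter>k. {f. cinner f (mult (\<lambda>z. cnj z ^ Suc k) unit_fun) = 0})"
    by (auto simp: H2_iff simp del: power_Suc)
  also have "closed \<dots>"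
    by (intro closed_INT ballI closed_Collect_eq continuous_on_cinner_left continuous_on_const)
  finally show ?thesis .
qed

lemmas H2_intros = csubspaceD[OF csubspace_H2] proj_in[OF csubspace_H2 closed_H2]

lemma unit_fun_H2 [simp]: "unit_fun \<in> H2"
proof -
  have "cinner unit_fun (mult (\<lambda>z. cnj z ^ Suc k) unit_fun) = (LINT z|circle. z ^ Suc k)" for k
    using Linfty_square_integrable[OF Linfty_continuous(4) square_integrable_const_one, of "Suc k"]
    by (simp add: unit_fun_def mult_abs_L2 cinner_abs_L2 square_integrable_const_one Linfty_continuous(4)[of "Suc k", simplified])
  then show ?thesis by (simp add: H2_iff circle_integral_power del: power_Suc)
qed

lemma Tz_add: "Tz (f + g) = Tz f + Tz g" and Tz_scaleC: "Tz (scaleC c f) = scaleC c (Tz f)"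
  and Tz_diff: "Tz (f - g) = Tz f - Tz g"
  by (simp_all add: Tz_def mult_add mult_scaleC mult_diff)

lemma norm_Tz: "norm (Tz f) = norm f"
  unfolding Tz_def by (rule norm_mult_unimodular) auto

lemma mult_cancel:
  assumes "\<phi> \<in> Linfty" "\<psi> \<in> Linfty" "\<And>z. cmod z = 1 \<Longrightarrow> \<phi> z * \<psi> z = 1"
  shows "mult \<phi> (mult \<psi> f) = f"
proof -
  have "mult \<phi> (mult \<psi> f) = mult (\<lambda>_. 1) f"
    unfolding mult_mult[OF assms(1,2)] by (intro mult_cong Linfty_mult assms Linfty_continuous)
  then show ?thesis by (simp add: mult_one)
qed

lemma z_cnj: "cmod z = 1 \<Longrightarrow> z * cnj z = 1" "cmod z = 1 \<Longrightarrow> cnj z * z = 1"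
  by (simp_all add: complex_norm_square[symmetric] mult.commute)

lemma mult_cnj_Tz: "mult cnj (Tz f) = f" and Tz_mult_cnj: "Tz (mult cnj f) = f"
  unfolding Tz_def by (auto intro!: mult_cancel simp: z_cnj)

lemma Tz_H2: "f \<in> H2 \<Longrightarrow> Tz f \<in> H2"
proof -
  assume f: "f \<in> H2"
  have "cinner (Tz f) (mult (\<lambda>z. cnj z ^ Suc k) unit_fun)
      = cinner f (mult (\<lambda>z. cnj z ^ Suc (Suc k)) unit_fun)" for k
    unfolding Tz_def by (simp add: cinner_mult_left mult_mult Linfty_continuous(4)[of "Suc k", simplified])
  with f show ?thesis by (auto simp: H2_iff simp del: power_Suc)
qed

text \<open>Subtracting the constant term first keeps the function in \<open>H2\<close>, where \<open>bshift\<close> is then the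
  adjoint of \<open>Tz\<close>; see \<open>cinner_Tz\<close>.\<close>

definition bshift :: "L2 \<Rightarrow> L2" where
  "bshift f = mult cnj (f - scaleC (cinner f unit_fun) unit_fun)"

lemma bshift_H2: assumes "f \<in> H2" shows "bshift f \<in> H2"
proof -
  let ?c = "cinner f unit_fun"
  have eq: "cinner (bshift f) (mult (\<lambda>z. cnj z ^ Suc k) unit_fun)
      = cinner (f - scaleC ?c unit_fun) (mult (\<lambda>z. cnj z ^ k) unit_fun)" for k
  proof -
    have "mult (\<lambda>z. z) (mult (\<lambda>z. cnj z ^ Suc k) unit_fun) = mult (\<lambda>z. cnj z ^ k) unit_fun"
      unfolding mult_mult[OF Linfty_continuous(1,4)]
      by (rule mult_cong[OF Linfty_mult]) (auto simp: mult.assoc[symmetric] z_cnj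
           intro: Linfty_continuous(4)[of "Suc k", simplified])
    then show ?thesis
      unfolding bshift_def by (subst cinner_mult_left) (simp_all del: power_Suc)
  qed
  have "cinner (f - scaleC ?c unit_fun) (mult (\<lambda>z. cnj z ^ k) unit_fun) = 0" for k
  proof (cases k)
    case 0
    then show ?thesis by (simp add: mult_one cinner_simps)
  next
    case (Suc l)
    then show ?thesis
      using assms unit_fun_H2 unfolding H2_iff by (simp add: cinner_simps del: power_Suc)
  qed
  then show ?thesis by (simp add: H2_iff eq del: power_Suc)
qed

lemma Tz_bshift: "Tz (bshift f) = f - scaleC (cinner f unit_fun) unit_fun"
  by (simp add: bshift_def Tz_mult_cnj)

lemma cinner_Tz_unit_fun: assumes "f \<in> H2" shows "cinner (Tz f) unit_fun = 0"
  using assms[unfolded H2_iff, rule_format, of 0] by (simp add: Tz_def cinner_mult_left)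

lemma bshift_Tz: "f \<in> H2 \<Longrightarrow> bshift (Tz f) = f"
  by (simp add: bshift_def cinner_Tz_unit_fun mult_cnj_Tz)

lemma bshift_add: "bshift (f + g) = bshift f + bshift g"
  and bshift_scaleC: "bshift (scaleC c f) = scaleC c (bshift f)"
  by (simp_all add: bshift_def cinner_simps scaleC_add_left mult_add mult_diff mult_scaleC
      scaleC_diff scaleC_scaleC)

lemma bshift_unit_fun [simp]: "bshift unit_fun = 0"
  using mult_diff[of cnj unit_fun unit_fun] by (simp add: bshift_def)

lemma cinner_Tz:
  assumes "f \<in> H2" "g \<in> H2" shows "cinner f (Tz g) = cinner (bshift f) g"
proof -
  have "cinner f (Tz g) = cinner (Tz (bshift f) + scaleC (cinner f unit_fun) unit_fun) (Tz g)"
    by (simp add: Tz_bshift)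
  also have "\<dots> = cinner (Tz (bshift f)) (Tz g)"
    using cinner_commute[of unit_fun "Tz g"] by (simp add: cinner_simps cinner_Tz_unit_fun assms)
  also have "\<dots> = cinner (bshift f) (mult cnj (Tz g))"
    unfolding Tz_def by (simp add: cinner_mult_left)
  finally show ?thesis by (simp add: mult_cnj_Tz)
qed

lemma norm_bshift:
  assumes "f \<in> H2" shows "(norm f)\<^sup>2 = (norm (bshift f))\<^sup>2 + (cmod (cinner f unit_fun))\<^sup>2"
proof -
  have "(norm (Tz (bshift f) + scaleC (cinner f unit_fun) unit_fun))\<^sup>2
      = (norm (Tz (bshift f)))\<^sup>2 + (norm (scaleC (cinner f unit_fun) unit_fun))\<^sup>2"
    by (rule norm_add_orthogonal) (simp add: cinner_simps cinner_Tz_unit_fun bshift_H2 assms)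
  moreover have "Tz (bshift f) + scaleC (cinner f unit_fun) unit_fun = f"
    by (simp add: Tz_bshift)
  ultimately show ?thesis by (simp add: norm_Tz norm_scaleC)
qed

section \<open>Extending a Hankel form by one antidiagonal\<close>

text \<open>The last clause says that the entries of the matrix of \<open>G\<close> in the basis of the monomials depend
  only on the sum of their indices.\<close>

definition hankel_bounded :: "real \<Rightarrow> (L2 \<Rightarrow> L2) \<Rightarrow> bool" where
  "hankel_bounded M G \<longleftrightarrow> (\<forall>f\<in>H2. G f \<in> H2) \<and>
     (\<forall>f\<in>H2. \<forall>g\<in>H2. G (f + g) = G f + G g) \<and>
     (\<forall>c. \<forall>f\<in>H2. G (scaleC c f) = scaleC c (G f)) \<and>
     (\<forall>f\<in>H2. norm (G f) \<le> M * norm f) \<and>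
     (\<forall>f\<in>H2. G (Tz f) = bshift (G f))"

lemma hankel_boundedD:
  assumes "hankel_bounded M G"
  shows "f \<in> H2 \<Longrightarrow> G f \<in> H2" "f \<in> H2 \<Longrightarrow> g \<in> H2 \<Longrightarrow> G (f + g) = G f + G g"
    "f \<in> H2 \<Longrightarrow> G (scaleC c f) = scaleC c (G f)" "f \<in> H2 \<Longrightarrow> norm (G f) \<le> M * norm f"
    "f \<in> H2 \<Longrightarrow> G (Tz f) = bshift (G f)"
    "f \<in> H2 \<Longrightarrow> g \<in> H2 \<Longrightarrow> G (f - g) = G f - G g"
    "f \<in> H2 \<Longrightarrow> G (r *\<^sub>R f) = r *\<^sub>R G f"
    "f \<in> H2 \<Longrightarrow> (norm (G f))\<^sup>2 \<le> M\<^sup>2 * (norm f)\<^sup>2"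
proof -
  show add: "f \<in> H2 \<Longrightarrow> g \<in> H2 \<Longrightarrow> G (f + g) = G f + G g"
    and sc: "f \<in> H2 \<Longrightarrow> G (scaleC c f) = scaleC c (G f)" for f g c
    using assms by (auto simp: hankel_bounded_def)
  show "f \<in> H2 \<Longrightarrow> g \<in> H2 \<Longrightarrow> G (f - g) = G f - G g"
    using add[of f "- g"] sc[of g "-1"] csubspaceD(3)[OF csubspace_H2, of g "-1"]
    by (simp add: uminus_eq_scaleC[symmetric])
  show "f \<in> H2 \<Longrightarrow> G f \<in> H2" "f \<in> H2 \<Longrightarrow> G (Tz f) = bshift (G f)"
    "f \<in> H2 \<Longrightarrow> G (r *\<^sub>R f) = r *\<^sub>R G f"
    using assms by (auto simp: hankel_bounded_def scaleR_eq_scaleC)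
  show le: "f \<in> H2 \<Longrightarrow> norm (G f) \<le> M * norm f"
    using assms by (auto simp: hankel_bounded_def)
  show "f \<in> H2 \<Longrightarrow> (norm (G f))\<^sup>2 \<le> M\<^sup>2 * (norm f)\<^sup>2"
    using power_mono[OF le, of 2] by (simp add: power_mult_distrib)
qed

text \<open>If \<open>G\<close> has the matrix \<open>(a\<^bsub>i+j\<^esub>)\<close>, then \<open>G'\<close> has the matrix \<open>(a\<^bsub>i+j-1\<^esub>)\<close>. Its rows from the
  second on are those of \<open>G\<close>, so \<open>G' f = S (G f) + r(f) 1\<close>, and its first row \<open>r\<close> is prescribed on
  \<open>S H\<^sup>2\<close> by \<open>r(S x) = \<langle>G x, 1\<rangle>\<close>; free is only \<open>r(1)\<close>. The bound for \<open>G'\<close> reads \<open>\<bar>r(f)\<bar>\<^sup>2 \<le> q(f)\<close>,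
  where \<open>q(f) = M\<^sup>2 \<parallel>f\<parallel>\<^sup>2 - \<parallel>G f\<parallel>\<^sup>2\<close>. On \<open>S H\<^sup>2\<close> it holds because
  \<open>\<bar>\<langle>G x, 1\<rangle>\<bar>\<^sup>2 = \<parallel>G x\<parallel>\<^sup>2 - \<parallel>S\<^sup>* G x\<parallel>\<^sup>2\<close> and \<open>S\<^sup>* G x = G (S x)\<close>. By homogeneity it remains to find
  \<open>d = - r(1)\<close> with \<open>\<bar>r(S x) - d\<bar>\<^sup>2 \<le> q(1 + S x)\<close> for all \<open>x\<close>, and \<open>minimising_point\<close> provides it.\<close>

lemma one_step_extension:
  assumes "hankel_bounded M G"
  obtains G' where "hankel_bounded M G'" "\<And>f. f \<in> H2 \<Longrightarrow> G' (Tz f) = G f"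
proof -
  note G = hankel_boundedD[OF assms]
  define q where "q f = M\<^sup>2 * (norm f)\<^sup>2 - (norm (G f))\<^sup>2" for f
  define v where "v x = unit_fun + Tz x" for x
  define \<rho> where "\<rho> x = cinner (G x) unit_fun" for x
  have H2_nonempty: "H2 \<noteq> {}" using unit_fun_H2 by blast
  have v: "v x \<in> H2" if "x \<in> H2" for x
    using that by (simp add: v_def H2_intros Tz_H2)
  have q: "0 \<le> q f" if "f \<in> H2" for f
    using G(8)[OF that] by (simp add: q_def)
  have q_convex: "q ((1 - t) *\<^sub>R f + t *\<^sub>R g) = (1 - t) * q f + t * q g - t * (1 - t) * q (f - g)"
    if "f \<in> H2" "g \<in> H2" for f g t
    using that
    by (simp add: q_def G H2_intros norm_convex_combination[of t f g]
        norm_convex_combination[of t "G f" "G g"]) (simp add: algebra_simps)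
  have v_convex: "v ((1 - t) *\<^sub>R x + t *\<^sub>R y) = (1 - t) *\<^sub>R v x + t *\<^sub>R v y" for x y t
  proof -
    have "(1 - t) *\<^sub>R unit_fun + t *\<^sub>R unit_fun = unit_fun"
      by (simp flip: scaleR_add_left)
    then show ?thesis
      by (simp add: v_def Tz_add Tz_scaleC scaleR_eq_scaleC scaleC_add algebra_simps)
  qed
  have \<rho>: "(cmod (\<rho> x))\<^sup>2 \<le> q (Tz x)" if x: "x \<in> H2" for x
  proof -
    have "(cmod (\<rho> x))\<^sup>2 = (norm (G x))\<^sup>2 - (norm (G (Tz x)))\<^sup>2"
      using norm_bshift[OF G(1)[OF x]] G(5)[OF x] by (simp add: \<rho>_def)
    also have "\<dots> \<le> q (Tz x)"
      using G(8)[OF x] by (simp add: q_def norm_Tz)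
    finally show ?thesis .
  qed
  have \<rho>_diff: "(dist (\<rho> x) (\<rho> y))\<^sup>2 \<le> q (v x - v y)" if xy: "x \<in> H2" "y \<in> H2" for x y
  proof -
    have "v x - v y = Tz (x - y)" by (simp add: v_def Tz_diff)
    moreover have "\<rho> x - \<rho> y = \<rho> (x - y)" by (simp add: \<rho>_def G xy cinner_diff_left)
    ultimately show ?thesis
      using \<rho>[of "x - y"] xy by (simp add: dist_norm H2_intros)
  qed
  have qv_convex: "q (v ((1 - t) *\<^sub>R x + t *\<^sub>R y))
      = (1 - t) * q (v x) + t * q (v y) - t * (1 - t) * q (v x - v y)"
    if "x \<in> H2" "y \<in> H2" for x y t
    unfolding v_convex by (intro q_convex v that)
  have "\<exists>d\<in>closure (\<rho> ` H2). \<forall>x\<in>H2. (dist d (\<rho> x))\<^sup>2 + Inf ((\<lambda>x. q (v x)) ` H2) \<le> q (v x)"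
    by (rule minimising_point[OF csubspace_convex[OF csubspace_H2] H2_nonempty q[OF v] qv_convex \<rho>_diff])
  then obtain d
    where d: "\<And>x. x \<in> H2 \<Longrightarrow> (dist d (\<rho> x))\<^sup>2 + Inf ((\<lambda>x. q (v x)) ` H2) \<le> q (v x)"
    by blast
  have "0 \<le> Inf ((\<lambda>x. q (v x)) ` H2)"
    using q v H2_nonempty by (intro cInf_greatest) auto
  then have d: "(cmod (\<rho> x - d))\<^sup>2 \<le> q (v x)" if "x \<in> H2" for x
    using d[OF that] by (simp add: dist_norm norm_minus_commute)
  define r where "r f = \<rho> (bshift f) - d * cinner f unit_fun" for f
  define G' where "G' f = Tz (G f) + scaleC (r f) unit_fun" for f
  have r: "(cmod (r f))\<^sup>2 \<le> q f" if f: "f \<in> H2" for f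
  proof (cases "cinner f unit_fun = 0")
    case True
    then have "r f = \<rho> (bshift f)" "Tz (bshift f) = f"
      by (simp_all add: r_def Tz_bshift)
    then show ?thesis using \<rho>[OF bshift_H2[OF f]] by simp
  next
    case False
    define c where "c = cinner f unit_fun"
    define x where "x = scaleC (1 / c) (bshift f)"
    have c: "c \<noteq> 0" using False by (simp add: c_def)
    have x: "x \<in> H2" by (simp add: x_def H2_intros bshift_H2 f)
    have "scaleC c (v x) = scaleC c unit_fun + Tz (bshift f)"
      using c by (simp add: v_def x_def Tz_scaleC scaleC_add scaleC_scaleC)
    then have f_eq: "f = scaleC c (v x)"
      by (simp add: Tz_bshift c_def)
    have "c * \<rho> x = \<rho> (bshift f)"
      using c by (simp add: \<rho>_def x_def G bshift_H2 f cinner_simps)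
    then have "(cmod (r f))\<^sup>2 = (cmod (c * (\<rho> x - d)))\<^sup>2"
      by (simp add: r_def c_def[symmetric] algebra_simps)
    also have "\<dots> = (cmod c)\<^sup>2 * (cmod (\<rho> x - d))\<^sup>2"
      by (simp add: norm_mult power_mult_distrib)
    also have "\<dots> \<le> (cmod c)\<^sup>2 * q (v x)"
      by (intro mult_left_mono d x) simp
    also have "\<dots> = q (scaleC c (v x))"
      by (simp add: q_def G v x norm_scaleC power_mult_distrib right_diff_distrib)
    also have "scaleC c (v x) = f" by (rule f_eq[symmetric])
    finally show ?thesis .
  qed
  have r_lin: "r (f + g) = r f + r g" "r (scaleC c f) = c * r f" if "f \<in> H2" "g \<in> H2" for f g c
    using that by (simp_all add: r_def \<rho>_def bshift_add bshift_scaleC G bshift_H2 cinner_simps algebra_simps)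
  have shifted: "G' (Tz f) = G f" if f: "f \<in> H2" for f
  proof -
    have "r (Tz f) = cinner (G f) unit_fun"
      by (simp add: r_def \<rho>_def bshift_Tz cinner_Tz_unit_fun f)
    then show ?thesis by (simp add: G'_def G f Tz_bshift)
  qed
  have "hankel_bounded M G'"
    unfolding hankel_bounded_def
  proof (intro conjI ballI allI)
    fix f g c assume f: "f \<in> H2" and g: "g \<in> H2"
    show "G' f \<in> H2"
      by (simp add: G'_def H2_intros Tz_H2 G f)
    show "G' (f + g) = G' f + G' g"
      by (simp add: G'_def G f g r_lin Tz_add scaleC_add_left)
    show "G' (scaleC c f) = scaleC c (G' f)"
      by (simp add: G'_def G f r_lin(2)[OF f f] Tz_scaleC scaleC_add scaleC_scaleC)
    have "(norm (G' f))\<^sup>2 = (norm (Tz (G f)))\<^sup>2 + (norm (scaleC (r f) unit_fun))\<^sup>2"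
      unfolding G'_def
      by (rule norm_add_orthogonal) (simp add: cinner_simps cinner_Tz_unit_fun G f)
    also have "\<dots> \<le> (M * norm f)\<^sup>2"
      using r[OF f] by (simp add: norm_Tz norm_scaleC q_def power_mult_distrib)
    finally show "norm (G' f) \<le> M * norm f"
      by (rule power2_le_imp_le) (use order_trans[OF norm_ge_zero G(4)[OF f]] in simp)
    have "bshift (G' f) = G f"
      by (simp add: G'_def bshift_add bshift_scaleC bshift_Tz G f)
    then show "G' (Tz f) = bshift (G' f)" by (simp add: shifted f)
  qed
  then show ?thesis using shifted by (rule that)
qed

lemma hankel_extensions:
  assumes "hankel_bounded M G"
  obtains E :: "nat \<Rightarrow> L2 \<Rightarrow> L2" where "E 0 = G" "\<And>n. hankel_bounded M (E n)"
    "\<And>n f. f \<in> H2 \<Longrightarrow> E (Suc n) (Tz f) = E n f"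
proof -
  have "\<exists>E. \<forall>n. (hankel_bounded M (E n) \<and> (n = 0 \<longrightarrow> E n = G)) \<and>
      (\<forall>f\<in>H2. E (Suc n) (Tz f) = E n f)"
  proof (rule dependent_nat_choice)
    show "\<exists>F. hankel_bounded M F \<and> (0 = 0 \<longrightarrow> F = G)" using assms by auto
  next
    fix F and n :: nat assume "hankel_bounded M F \<and> (n = 0 \<longrightarrow> F = G)"
    then obtain F' where "hankel_bounded M F'" "\<And>f. f \<in> H2 \<Longrightarrow> F' (Tz f) = F f"
      using one_step_extension by blast
    then show "\<exists>F'. (hankel_bounded M F' \<and> (Suc n = 0 \<longrightarrow> F' = G)) \<and> (\<forall>f\<in>H2. F' (Tz f) = F f)"
      by auto
  qed
  with that show ?thesis by metis
qed

section \<open>The square integrable symbol\<close>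

lemma mult_add_left:
  assumes "\<phi> \<in> Linfty" "\<psi> \<in> Linfty" "(\<lambda>z. \<phi> z + \<psi> z) \<in> Linfty"
  shows "mult (\<lambda>z. \<phi> z + \<psi> z) f = mult \<phi> f + mult \<psi> f"
  using assms
  by transfer (auto intro!: L2_rel_eqI simp: L2_rel_def square_integrable_add
      Linfty_square_integrable distrib_right)

lemma mult_const: "mult (\<lambda>_. c) f = scaleC c f"
  using Linfty_continuous(7)[of c] by transfer (simp add: L2_rel_def square_integrable_cmult)

lemma mult_power_H2: "f \<in> H2 \<Longrightarrow> mult (\<lambda>z. z ^ n) f \<in> H2"
proof (induction n)
  case (Suc n)
  have "mult (\<lambda>z. z ^ Suc n) f = Tz (mult (\<lambda>z. z ^ n) f)"
    unfolding Tz_def by (simp add: mult_mult)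
  then show ?case using Suc by (simp add: Tz_H2 del: power_Suc)
qed (simp add: mult_one)

lemma mult_poly_pCons:
  "mult (poly (pCons a p)) unit_fun = scaleC a unit_fun + Tz (mult (poly p) unit_fun)"
proof -
  have "mult (\<lambda>z. a + z * poly p z) unit_fun
      = mult (\<lambda>_. a) unit_fun + mult (\<lambda>z. z * poly p z) unit_fun"
    by (rule mult_add_left) (auto intro!: continuous_in_Linfty continuous_intros)
  moreover have "poly (pCons a p) = (\<lambda>z. a + z * poly p z)" by (simp add: fun_eq_iff)
  ultimately show ?thesis by (simp add: mult_const Tz_def mult_mult)
qed

lemma mult_poly_H2: "mult (poly p) unit_fun \<in> H2"
proof (induction p)
  case 0
  show ?case by (simp add: mult_const H2_intros)
next
  case (pCons a p)
  then show ?case by (simp add: mult_poly_pCons H2_intros Tz_H2 del: poly_pCons)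
qed

text \<open>The first column of the \<open>n\<close>-th extension, shifted back by \<open>n\<close>, is
  \<open>e\<^sub>n = \<Sum> a\<^sub>k z\<^sup>k\<close> over \<open>k \<ge> -n\<close>. These are the truncations of one series; by orthogonality their
  norms increase, by the uniform bound on the extensions the norms are bounded, and so the series
  converges in \<open>L\<^sup>2\<close>. The limit \<open>\<Phi>\<close> reproduces the entries of all extensions. The polynomial is
  evaluated at \<open>cnj z\<close> since a Hankel operator flips its argument.\<close>

lemma hankel_L2_symbol:
  fixes E :: "nat \<Rightarrow> L2 \<Rightarrow> L2"
  assumes E: "\<And>n. hankel_bounded M (E n)"
    and ext: "\<And>n f. f \<in> H2 \<Longrightarrow> E (Suc n) (Tz f) = E n f"
  obtains \<Phi> where "\<And>n p g. g \<in> H2 \<Longrightarrow>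
    cinner (mult (\<lambda>z. z ^ n * poly p (cnj z)) \<Phi>) g = cinner (E n (mult (poly p) unit_fun)) g"
proof -
  define e where "e n = mult (\<lambda>z. cnj z ^ n) (E n unit_fun)" for n
  have E1: "E n unit_fun \<in> H2" for n by (rule hankel_boundedD[OF E unit_fun_H2])
  have shift: "cinner (E (n + k) unit_fun) (mult (\<lambda>z. z ^ k) g) = cinner (E n unit_fun) g"
    if "g \<in> H2" for n k g
  proof (induction k)
    case (Suc k)
    have "mult (\<lambda>z. z ^ Suc k) g = Tz (mult (\<lambda>z. z ^ k) g)"
      unfolding Tz_def by (simp add: mult_mult)
    then have "cinner (E (n + Suc k) unit_fun) (mult (\<lambda>z. z ^ Suc k) g)
        = cinner (E (Suc (n + k)) unit_fun) (Tz (mult (\<lambda>z. z ^ k) g))"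
      by (simp only: add_Suc_right)
    also have "\<dots> = cinner (bshift (E (Suc (n + k)) unit_fun)) (mult (\<lambda>z. z ^ k) g)"
      by (intro cinner_Tz E1 mult_power_H2 that)
    also have "bshift (E (Suc (n + k)) unit_fun) = E (n + k) unit_fun"
      by (simp only: hankel_boundedD(5)[OF E unit_fun_H2, symmetric] ext[OF unit_fun_H2])
    finally show ?case using Suc by simp
  qed (simp add: mult_one)
  have e_cinner: "cinner (e m) (mult (\<lambda>z. cnj z ^ n) g) = cinner (E n unit_fun) g"
    if nm: "n \<le> m" and g: "g \<in> H2" for m n g
  proof -
    obtain k where m: "m = n + k" using le_iff_add nm by blast
    have "cinner (e m) (mult (\<lambda>z. cnj z ^ n) g)
        = cinner (E m unit_fun) (mult (\<lambda>z. z ^ m) (mult (\<lambda>z. cnj z ^ n) g))"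
      by (simp add: e_def cinner_mult_left)
    also have "mult (\<lambda>z. z ^ m) (mult (\<lambda>z. cnj z ^ n) g) = mult (\<lambda>z. z ^ k) g"
    proof -
      have "z ^ m * cnj z ^ n = z ^ k" if "cmod z = 1" for z
      proof -
        have "z ^ m * cnj z ^ n = z ^ k * (z * cnj z) ^ n"
          by (simp add: m power_add power_mult_distrib)
        then show ?thesis by (simp only: z_cnj(1)[OF that] power_one mult_1_right)
      qed
      then show ?thesis by (simp add: mult_mult) (rule mult_cong[OF Linfty_mult], auto)
    qed
    finally show ?thesis by (simp add: m shift g)
  qed
  have norm_e: "norm (e n) = norm (E n unit_fun)" for n
    unfolding e_def by (rule norm_mult_unimodular) (auto simp: norm_power)
  have pyth: "(norm (e m - e n))\<^sup>2 = (norm (e m))\<^sup>2 - (norm (e n))\<^sup>2" if "n \<le> m" for m n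
  proof -
    have "cinner (e m) (e n) = of_real ((norm (e n))\<^sup>2)"
      using e_cinner[OF that E1[of n]] by (simp add: e_def[of n, symmetric] cinner_self norm_e)
    then have "inner (e m) (e n) = (norm (e n))\<^sup>2" by (simp add: inner_L2_def)
    then show ?thesis
      by (simp add: power2_norm_eq_inner inner_simps inner_commute)
  qed
  have "incseq (\<lambda>n. (norm (e n))\<^sup>2)"
    using pyth by (intro incseq_SucI) (metis le_SucI order_refl zero_le_power2 diff_ge_0_iff_ge)
  moreover have "(norm (e n))\<^sup>2 \<le> M\<^sup>2" for n
    using hankel_boundedD(8)[OF E[of n] unit_fun_H2] by (simp add: norm_e)
  ultimately have "convergent (\<lambda>n. (norm (e n))\<^sup>2)"
    by (metis incseq_convergent convergent_def)
  then have Cau: "Cauchy (\<lambda>n. (norm (e n))\<^sup>2)" by (rule convergent_Cauchy)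
  have "Cauchy e"
  proof (rule metric_CauchyI)
    fix r :: real assume "r > 0"
    then obtain N where N: "\<And>m n. m \<ge> N \<Longrightarrow> n \<ge> N \<Longrightarrow> dist ((norm (e m))\<^sup>2) ((norm (e n))\<^sup>2) < r\<^sup>2"
      using metric_CauchyD[OF Cau, of "r\<^sup>2"] by auto
    have *: "dist (e m) (e n) < r" if "m \<ge> N" "n \<ge> N" "n \<le> m" for m n
      by (rule power_less_imp_less_base[of _ 2])
        (use N[OF that(1,2)] pyth[OF that(3)] \<open>r > 0\<close> in \<open>auto simp: dist_norm\<close>)
    have "dist (e m) (e n) < r" if "m \<ge> N" "n \<ge> N" for m n
      using *[of m n] *[of n m] that by (cases "n \<le> m") (auto simp: dist_commute)
    then show "\<exists>N. \<forall>m\<ge>N. \<forall>n\<ge>N. dist (e m) (e n) < r" by blast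
  qed
  then obtain \<Phi> where lim: "e \<longlonglongrightarrow> \<Phi>"
    by (auto simp: Cauchy_convergent_iff convergent_def)
  have base: "cinner \<Phi> (mult (\<lambda>z. cnj z ^ n) g) = cinner (E n unit_fun) g" if "g \<in> H2" for n g
  proof (rule LIMSEQ_unique)
    show "(\<lambda>m. cinner (e m) (mult (\<lambda>z. cnj z ^ n) g)) \<longlonglongrightarrow> cinner \<Phi> (mult (\<lambda>z. cnj z ^ n) g)"
      by (rule bounded_linear.tendsto[OF bounded_linear_cinner_left lim])
    have "\<forall>\<^sub>F m in sequentially. cinner (e m) (mult (\<lambda>z. cnj z ^ n) g) = cinner (E n unit_fun) g"
      using eventually_ge_at_top[of n] by eventually_elim (simp add: e_cinner that)
    then show "(\<lambda>m. cinner (e m) (mult (\<lambda>z. cnj z ^ n) g)) \<longlonglongrightarrow> cinner (E n unit_fun) g"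
      by (rule tendsto_eventually)
  qed
  have "cinner (mult (\<lambda>z. z ^ n * poly p (cnj z)) \<Phi>) g = cinner (E n (mult (poly p) unit_fun)) g"
    if "g \<in> H2" for n p g
    using that
  proof (induction p arbitrary: g)
    case 0
    have "E n 0 = 0"
      using hankel_boundedD(6)[OF E unit_fun_H2 unit_fun_H2] by simp
    then show ?case by (simp add: mult_const)
  next
    case (pCons a p)
    have split: "(\<lambda>z. z ^ n * poly (pCons a p) (cnj z)) = (\<lambda>z. a * z ^ n + cnj z * (z ^ n * poly p (cnj z)))"
      by (simp add: fun_eq_iff algebra_simps)
    have in1: "(\<lambda>z. z ^ n * poly p (cnj z)) \<in> Linfty"
      by (intro Linfty_mult Linfty_continuous)
    have in2: "(\<lambda>z. a * z ^ n) \<in> Linfty"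
      by (intro Linfty_mult Linfty_continuous)
    have "mult (\<lambda>z. z ^ n * poly (pCons a p) (cnj z)) \<Phi>
        = mult (\<lambda>z. a * z ^ n) \<Phi> + mult (\<lambda>z. cnj z * (z ^ n * poly p (cnj z))) \<Phi>"
      unfolding split
      by (rule mult_add_left) (auto intro!: continuous_in_Linfty continuous_intros)
    also have "mult (\<lambda>z. a * z ^ n) \<Phi> = scaleC a (mult (\<lambda>z. z ^ n) \<Phi>)"
      using mult_mult[of "\<lambda>_. a" "\<lambda>z. z ^ n" \<Phi>] by (simp add: mult_const)
    also have "mult (\<lambda>z. cnj z * (z ^ n * poly p (cnj z))) \<Phi> = mult cnj (mult (\<lambda>z. z ^ n * poly p (cnj z)) \<Phi>)"
      by (simp add: mult_mult in1)
    finally have "cinner (mult (\<lambda>z. z ^ n * poly (pCons a p) (cnj z)) \<Phi>) g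
        = a * cinner \<Phi> (mult (\<lambda>z. cnj z ^ n) g)
          + cinner (mult (\<lambda>z. z ^ n * poly p (cnj z)) \<Phi>) (Tz g)"
      by (simp add: cinner_simps cinner_mult_left Tz_def)
    also have "\<dots> = a * cinner (E n unit_fun) g + cinner (E n (mult (poly p) unit_fun)) (Tz g)"
      using pCons by (simp add: base Tz_H2)
    also have "cinner (E n (mult (poly p) unit_fun)) (Tz g) = cinner (E n (Tz (mult (poly p) unit_fun))) g"
      using pCons.prems by (simp add: cinner_Tz hankel_boundedD[OF E] mult_poly_H2)
    also have "a * cinner (E n unit_fun) g + \<dots> = cinner (E n (mult (poly (pCons a p)) unit_fun)) g"
      by (simp add: mult_poly_pCons hankel_boundedD[OF E] H2_intros Tz_H2 mult_poly_H2 cinner_simps del: poly_pCons)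
    finally show ?case .
  qed
  then show ?thesis by (rule that)
qed

section \<open>Boundedness from quadratic estimates with trigonometric polynomials\<close>

text \<open>The indicator of a compact set is a limit of squares of bounded continuous functions, so
  \<open>h\<close> has a nonnegative integral over every compact set. Compact subsets of \<open>{h < 0}\<close> are then null sets, and by inner regularity
  \<open>{h < 0}\<close> is one, too.\<close>

lemma nonneg_AE_of_squares:
  fixes h :: "complex \<Rightarrow> real"
  assumes h: "integrable circle h"
    and sq: "\<And>g. continuous_on UNIV g \<Longrightarrow> 0 \<le> (LINT z|circle. h z * (g z)\<^sup>2)"
  shows "AE z in circle. 0 \<le> h z"
proof -
  define A where "A = {z \<in> space circle. h z < 0}"
  have hm [measurable]: "h \<in> borel_measurable circle" using h by auto
  have A: "A \<in> sets circle" unfolding A_def by measurable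
  \<comment> \<open>Inner regularity concerns Borel measures on the whole space, so arc length is moved to the plane.\<close>
  define \<mu> where "\<mu> = distr circle borel (\<lambda>z. z)"
  have id: "(\<lambda>z. z) \<in> circle \<rightarrow>\<^sub>M borel"
    by (rule borel_measurable_circleI) simp
  have emeasure_\<mu>: "emeasure \<mu> B = emeasure circle (B \<inter> sphere 0 1)" if "B \<in> sets borel" for B
    using that id by (simp add: \<mu>_def emeasure_distr)
  have Ab: "A \<in> sets borel" "A \<subseteq> sphere 0 1"
    using A by (auto simp: A_def sets_restrict_space_iff)
  have null: "emeasure \<mu> K = 0" if K: "K \<subseteq> A" "compact K" for K
  proof (cases "K = {}")
    case False
    have Kb: "K \<in> sets borel" "closed K" using K by (auto simp: compact_imp_closed)
    define g where "g n z = max 0 (1 - real n * infdist z K)" for n z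
    have g_cont: "continuous_on UNIV (g n)" for n
      unfolding g_def by (intro continuous_intros)
    have g_le: "\<bar>g n z\<bar> \<le> 1" for n z
      using mult_nonneg_nonneg[of "real n" "infdist z K"] infdist_nonneg[of z K] by (auto simp: g_def)
    have g_lim: "(\<lambda>n. g n z) \<longlonglongrightarrow> indicator K z" for z
    proof (cases "z \<in> K")
      case True
      then show ?thesis by (simp add: g_def)
    next
      case zK: False
      then have pos: "infdist z K > 0"
        using Kb False by (simp add: infdist_pos_not_in_closed)
      have "\<forall>\<^sub>F n in sequentially. g n z = 0"
        using eventually_ge_at_top[of "nat \<lceil>1 / infdist z K\<rceil>"]
      proof eventually_elim
        fix n assume "n \<ge> nat \<lceil>1 / infdist z K\<rceil>"
        then have "real n \<ge> 1 / infdist z K" by linarith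
        then show "g n z = 0" using pos by (simp add: g_def field_simps)
      qed
      then show ?thesis using zK by (simp add: tendsto_eventually)
    qed
    have g_meas [measurable]: "g n \<in> borel_measurable circle" for n
      by (intro borel_measurable_circleI borel_measurable_continuous_onI g_cont)
    have K_meas [measurable]: "K \<in> sets circle"
      using K Ab Kb by (auto simp: sets_restrict_space_iff)
    have int: "integrable circle (\<lambda>z. h z * indicator K z)"
      using h K_meas by (rule integrable_real_mult_indicator[rotated])
    have "(\<lambda>n. LINT z|circle. h z * (g n z)\<^sup>2) \<longlonglongrightarrow> (LINT z|circle. h z * (indicator K z)\<^sup>2)"
    proof (rule integral_dominated_convergence[where w="\<lambda>z. \<bar>h z\<bar>"])
      show "AE z in circle. norm (h z * (g n z)\<^sup>2) \<le> \<bar>h z\<bar>" for n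
      proof (rule AE_I2)
        fix z
        have "(g n z)\<^sup>2 \<le> 1" using g_le[of n z] by (simp add: abs_square_le_1)
        then show "norm (h z * (g n z)\<^sup>2) \<le> \<bar>h z\<bar>"
          by (simp add: abs_mult mult_left_le)
      qed
      show "AE z in circle. (\<lambda>n. h z * (g n z)\<^sup>2) \<longlonglongrightarrow> h z * (indicator K z)\<^sup>2"
        by (intro AE_I2 tendsto_intros g_lim)
    qed (use h in auto)
    moreover have "(\<lambda>z. h z * (indicator K z)\<^sup>2) = (\<lambda>z. h z * indicator K z)"
      by (auto simp: indicator_def)
    ultimately have "0 \<le> (LINT z|circle. h z * indicator K z)"
      using sq[OF g_cont] by (intro LIMSEQ_le_const) auto
    moreover have neg: "h z * indicator K z \<le> 0" for z
      using K by (auto simp: A_def indicator_def)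
    then have "0 \<le> (LINT z|circle. - (h z * indicator K z))"
      by (intro Bochner_Integration.integral_nonneg) simp
    ultimately have "(LINT z|circle. - (h z * indicator K z)) = 0" by simp
    then have "AE z in circle. - (h z * indicator K z) = 0"
      using int neg by (subst (asm) integral_nonneg_eq_0_iff_AE) (auto simp: mult_le_0_iff)
    then have "AE z in circle. z \<notin> K"
      by eventually_elim (use K in \<open>auto simp: A_def indicator_def split: if_splits\<close>)
    then have "emeasure circle K = 0"
      using AE_iff_null_sets[OF K_meas] by (simp add: null_setsD1)
    then show ?thesis
      using K Ab by (simp add: emeasure_\<mu> Kb Int_absorb2)
  qed simp
  have "emeasure \<mu> A = (SUP K\<in>{K. K \<subseteq> A \<and> compact K}. emeasure \<mu> K)"
  proof (rule inner_regular)
    show "emeasure \<mu> (space \<mu>) \<noteq> \<infinity>"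
    proof -
      have "space \<mu> = UNIV" by (simp add: \<mu>_def)
      then show ?thesis using emeasure_space_circle emeasure_\<mu>[of UNIV] by simp
    qed
  qed (use Ab in \<open>auto simp: \<mu>_def\<close>)
  also have "\<dots> = 0" using null by (auto intro!: antisym SUP_least)
  finally have "emeasure circle A = 0" using Ab by (simp add: emeasure_\<mu> Int_absorb2)
  then have "AE z in circle. z \<notin> A" 
    using AE_iff_null_sets[OF A] \<open>emeasure circle A = 0\<close> A by (simp add: null_setsI)
  then show ?thesis using AE_space by eventually_elim (auto simp: A_def)
qed

text \<open>The estimate passes from polynomials to continuous functions by uniform approximation. For a
  unimodular constant \<open>c\<close> it says that \<open>M - Re (c \<phi>)\<close> has nonnegative integrals against squares.
  All \<open>c\<close> together would give the bound \<open>M\<close>; the four values \<open>\<plusminus>1\<close> and \<open>\<plusminus>\<i>\<close> bound real and imaginary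
  part, whence the factor 2.\<close>

lemma AE_bounded_of_polynomials:
  fixes \<phi> :: "complex \<Rightarrow> complex"
  assumes \<phi>: "integrable circle \<phi>"
    and est: "\<And>p. real_polynomial_function p \<Longrightarrow>
      cmod (LINT z|circle. \<phi> z * of_real ((p z)\<^sup>2)) \<le> M * (LINT z|circle. (p z)\<^sup>2)"
  shows "AE z in circle. cmod (\<phi> z) \<le> 2 * M"
proof -
  interpret finite_measure circle by (rule finite_measure_circle)
  have [measurable]: "\<phi> \<in> borel_measurable circle" using \<phi> by auto
  have cont: "cmod (LINT z|circle. \<phi> z * of_real ((g z)\<^sup>2)) \<le> M * (LINT z|circle. (g z)\<^sup>2)"
    if g: "continuous_on UNIV g" for g :: "complex \<Rightarrow> real"
  proof -
    obtain B where B: "\<And>z. cmod z = 1 \<Longrightarrow> \<bar>g z\<bar> \<le> B"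
      using continuous_bounded_on_circle[OF g] by auto
    have "\<exists>p. real_polynomial_function p \<and> (\<forall>z\<in>sphere 0 1. \<bar>g z - p z\<bar> < 1 / Suc n)" for n
      using Stone_Weierstrass_real_polynomial_function[of "sphere 0 1" g "1 / Suc n"]
        continuous_on_subset[OF g] by (metis compact_sphere of_nat_0_less_iff subset_UNIV zero_less_Suc zero_less_divide_1_iff)
    then obtain p where p: "\<And>n. real_polynomial_function (p n)"
      "\<And>n z. cmod z = 1 \<Longrightarrow> \<bar>g z - p n z\<bar> < 1 / Suc n"
      by (metis mem_sphere_0)
    have [measurable]: "g \<in> borel_measurable circle" "p n \<in> borel_measurable circle" for n
      by (intro borel_measurable_circleI borel_measurable_continuous_onI g
          continuous_real_polymonial_function[OF p(1)] continuous_at_imp_continuous_on ballI)+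
    have lim: "(\<lambda>n. p n z) \<longlonglongrightarrow> g z" if "cmod z = 1" for z
    proof (rule LIMSEQ_I)
      fix r :: real assume "r > 0"
      then obtain N where N: "1 / Suc N < r" using nat_approx_posE by blast
      have "norm (p n z - g z) < r" if "n \<ge> N" for n
      proof -
        have "1 / Suc n \<le> 1 / Suc N" using that by (simp add: field_simps)
        then show ?thesis using p(2)[OF \<open>cmod z = 1\<close>, of n] N by (simp add: abs_minus_commute)
      qed
      then show "\<exists>no. \<forall>n\<ge>no. norm (p n z - g z) < r" by blast
    qed
    have bound: "(p n z)\<^sup>2 \<le> (B + 1)\<^sup>2" if "cmod z = 1" for n z
    proof -
      have "1 / Suc n \<le> (1::real)" by simp
      then have "\<bar>p n z\<bar> \<le> B + 1" using p(2)[OF that, of n] B[OF that] by linarith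
      then show ?thesis by (metis abs_ge_zero power2_abs power_mono)
    qed
    have "(\<lambda>n. LINT z|circle. \<phi> z * of_real ((p n z)\<^sup>2)) \<longlonglongrightarrow> (LINT z|circle. \<phi> z * of_real ((g z)\<^sup>2))"
    proof (rule integral_dominated_convergence[where w="\<lambda>z. cmod (\<phi> z) * (B + 1)\<^sup>2"])
      show "AE z in circle. (\<lambda>n. \<phi> z * of_real ((p n z)\<^sup>2)) \<longlonglongrightarrow> \<phi> z * of_real ((g z)\<^sup>2)"
        by (intro AE_I2 tendsto_intros lim) simp
      show "AE z in circle. norm (\<phi> z * of_real ((p n z)\<^sup>2)) \<le> cmod (\<phi> z) * (B + 1)\<^sup>2" for n
        by (rule AE_I2) (auto simp: norm_mult norm_power intro!: mult_left_mono bound)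
    qed (use \<phi> in auto)
    moreover have "(\<lambda>n. LINT z|circle. (p n z)\<^sup>2) \<longlonglongrightarrow> (LINT z|circle. (g z)\<^sup>2)"
    proof (rule integral_dominated_convergence[where w="\<lambda>_. (B + 1)\<^sup>2"])
      show "AE z in circle. (\<lambda>n. (p n z)\<^sup>2) \<longlonglongrightarrow> (g z)\<^sup>2"
        by (intro AE_I2 tendsto_intros lim) simp
      show "AE z in circle. norm ((p n z)\<^sup>2) \<le> (B + 1)\<^sup>2" for n
        by (rule AE_I2) (auto intro!: bound)
    qed auto
    ultimately show ?thesis
      by (rule LIMSEQ_le[OF tendsto_norm tendsto_mult_left]) (use est p(1) in blast)
  qed
  have rotated: "AE z in circle. Re (c * \<phi> z) \<le> M" if c: "cmod c = 1" for c
  proof -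
    have "AE z in circle. 0 \<le> M - Re (c * \<phi> z)"
    proof (rule nonneg_AE_of_squares)
      show "integrable circle (\<lambda>z. M - Re (c * \<phi> z))"
        using \<phi> by (intro Bochner_Integration.integrable_diff integrable_Re) auto
    next
      fix g :: "complex \<Rightarrow> real" assume g: "continuous_on UNIV g"
      obtain B where B: "\<And>z. cmod z = 1 \<Longrightarrow> \<bar>g z\<bar> \<le> B"
        using continuous_bounded_on_circle[OF g] by auto
      have B2: "(g z)\<^sup>2 \<le> B\<^sup>2" if "cmod z = 1" for z
        using B[OF that] by (metis abs_ge_zero power2_abs power_mono)
      have [measurable]: "g \<in> borel_measurable circle"
        by (intro borel_measurable_circleI borel_measurable_continuous_onI g)
      have i1: "integrable circle (\<lambda>z. (g z)\<^sup>2)"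
        by (rule integrable_const_bound[of _ "B\<^sup>2"]) (auto intro!: AE_I2 B2)
      have i2: "integrable circle (\<lambda>z. \<phi> z * of_real ((g z)\<^sup>2))"
      proof (rule Bochner_Integration.integrable_bound)
        show "integrable circle (\<lambda>z. cmod (\<phi> z) * B\<^sup>2)" using \<phi> by auto
        show "AE z in circle. norm (\<phi> z * of_real ((g z)\<^sup>2)) \<le> norm (cmod (\<phi> z) * B\<^sup>2)"
          by (rule AE_I2) (auto simp: norm_mult norm_power abs_mult intro!: mult_left_mono B2)
      qed simp
      have "(LINT z|circle. (M - Re (c * \<phi> z)) * (g z)\<^sup>2)
          = (LINT z|circle. M * (g z)\<^sup>2 - Re (c * (\<phi> z * of_real ((g z)\<^sup>2))))"
        by (intro Bochner_Integration.integral_cong refl) (simp add: algebra_simps)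
      also have "\<dots> = M * (LINT z|circle. (g z)\<^sup>2) - Re (c * (LINT z|circle. \<phi> z * of_real ((g z)\<^sup>2)))"
        using i1 i2 by (subst Bochner_Integration.integral_diff) (auto simp del: Re_complex_of_real times_complex.sel)
      finally have eq: "(LINT z|circle. (M - Re (c * \<phi> z)) * (g z)\<^sup>2)
          = M * (LINT z|circle. (g z)\<^sup>2) - Re (c * (LINT z|circle. \<phi> z * of_real ((g z)\<^sup>2)))" .
      have "Re (c * (LINT z|circle. \<phi> z * of_real ((g z)\<^sup>2))) \<le> M * (LINT z|circle. (g z)\<^sup>2)"
        using order_trans[OF complex_Re_le_cmod, of "c * (LINT z|circle. \<phi> z * of_real ((g z)\<^sup>2))"] cont[OF g]
        by (simp add: norm_mult c del: times_complex.sel)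
      then show "0 \<le> (LINT z|circle. (M - Re (c * \<phi> z)) * (g z)\<^sup>2)" unfolding eq by linarith
    qed
    then show ?thesis by simp
  qed
  show ?thesis
    using rotated[of 1, simplified] rotated[of "-1", simplified]
      rotated[of \<i>, simplified] rotated[of "-\<i>", simplified]
  proof eventually_elim
    fix z assume "Re (\<phi> z) \<le> M" "- Re (\<phi> z) \<le> M" "- Im (\<phi> z) \<le> M" "Im (\<phi> z) \<le> M"
    then show "cmod (\<phi> z) \<le> 2 * M" using cmod_le[of "\<phi> z"] by linarith
  qed
qed

text \<open>Real polynomials in the two coordinates are trigonometric polynomials on the circle, written
  here as \<open>z\<^sup>-\<^sup>N P(z)\<close>: there \<open>cnj z = 1/z\<close>, so both coordinates are rational functions of \<open>z\<close> with
  denominator \<open>z\<close>.\<close>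

lemma real_polynomial_on_circle:
  assumes "real_polynomial_function (p :: complex \<Rightarrow> real)"
  shows "\<exists>N P. \<forall>z. cmod z = 1 \<longrightarrow> of_real (p z) * z ^ N = poly P z"
  using assms
proof induction
  case (linear p)
  interpret bounded_linear p by fact
  have "of_real (p z) * z ^ 1
      = poly [: of_real (p 1) / 2 + \<i> * of_real (p \<i>) / 2, 0, of_real (p 1) / 2 - \<i> * of_real (p \<i>) / 2 :] z"
    if z: "cmod z = 1" for z
  proof -
    have "p z = p (Re z *\<^sub>R 1 + Im z *\<^sub>R \<i>)"
      by (rule arg_cong[of _ _ p]) (simp add: complex_eq_iff)
    also have "\<dots> = Re z * p 1 + Im z * p \<i>" by (simp add: add scaleR)
    finally have "of_real (p z) * z = (of_real (Re z) * of_real (p 1) + of_real (Im z) * of_real (p \<i>)) * z"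
      by simp
    also have "of_real (Re z) = (z + cnj z) / 2" by (simp add: complex_eq_iff)
    also have "of_real (Im z) = - \<i> * (z - cnj z) / 2" by (simp add: complex_eq_iff)
    also have "((z + cnj z) / 2 * of_real (p 1) + - \<i> * (z - cnj z) / 2 * of_real (p \<i>)) * z
        = (z * z + z * cnj z) / 2 * of_real (p 1) - \<i> * (z * z - z * cnj z) / 2 * of_real (p \<i>)"
      by (simp add: ring_distribs add_divide_distrib diff_divide_distrib mult_ac)
    finally show ?thesis unfolding z_cnj(1)[OF z] by (simp add: field_simps)
  qed
  then show ?case by blast
next
  case (const c)
  have "of_real c * z ^ 0 = poly [:of_real c:] z" for z :: complex by simp
  then show ?case by blast
next
  case (add f g)
  then obtain N P N' P' where *: "\<And>z. cmod z = 1 \<Longrightarrow> of_real (f z) * z ^ N = poly P z"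
    "\<And>z. cmod z = 1 \<Longrightarrow> of_real (g z) * z ^ N' = poly P' z" by metis
  have "of_real (f z + g z) * z ^ (N + N') = poly (P * monom 1 N' + P' * monom 1 N) z"
    if "cmod z = 1" for z
    by (simp add: poly_monom *[OF that, symmetric] power_add algebra_simps)
  then show ?case by blast
next
  case (mult f g)
  then obtain N P N' P' where *: "\<And>z. cmod z = 1 \<Longrightarrow> of_real (f z) * z ^ N = poly P z"
    "\<And>z. cmod z = 1 \<Longrightarrow> of_real (g z) * z ^ N' = poly P' z" by metis
  have "of_real (f z * g z) * z ^ (N + N') = poly (P * P') z"
    if "cmod z = 1" for z
    by (simp add: *[OF that, symmetric] power_add algebra_simps)
  then show ?case by blast
qed

lemma real_polynomial_Linfty:
  assumes "real_polynomial_function p" shows "(\<lambda>z. complex_of_real (p z)) \<in> Linfty"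
  by (intro continuous_in_Linfty continuous_on_of_real continuous_at_imp_continuous_on ballI
      continuous_real_polymonial_function assms)

lemma norm_mult_unit_fun:
  assumes "(\<lambda>z. complex_of_real (p z)) \<in> Linfty"
  shows "(norm (mult (\<lambda>z. of_real (p z)) unit_fun))\<^sup>2 = (LINT z|circle. (p z)\<^sup>2)"
  using Linfty_square_integrable[OF assms square_integrable_const_one]
  by (simp add: unit_fun_def mult_abs_L2 assms square_integrable_const_one norm_abs_L2)

lemma mult_eqI_circle:
  assumes "\<phi> \<in> Linfty" "\<psi> \<in> Linfty" "\<theta> \<in> Linfty" "\<And>z. cmod z = 1 \<Longrightarrow> \<theta> z = \<phi> z * \<psi> z"
  shows "mult \<phi> (mult \<psi> f) = mult \<theta> f"
  using assms by (simp add: mult_mult) (rule mult_cong[OF Linfty_mult], auto)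

section \<open>Polynomials are dense in the Hardy space\<close>

text \<open>For \<open>f\<close> in \<open>H2\<close> orthogonality to \<open>z\<^sup>n\<close> with \<open>n \<ge> 0\<close> is orthogonality to all trigonometric
  monomials. The criterion with \<open>M = 0\<close> then says that \<open>f\<close> vanishes almost everywhere.\<close>

lemma H2_eq_0I:
  assumes f: "f \<in> H2" and orth: "\<And>P. cinner f (mult (poly P) unit_fun) = 0"
  shows "f = 0"
proof -
  have orth_power: "cinner (mult (\<lambda>z. z ^ n) f) (mult (poly P) unit_fun) = 0" for n P
  proof (induction n arbitrary: P)
    case 0
    then show ?case by (simp add: mult_one orth)
  next
    case (Suc n)
    have eq: "mult (\<lambda>z. z ^ Suc n) f = Tz (mult (\<lambda>z. z ^ n) f)"
      unfolding Tz_def by (simp add: mult_mult)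
    have h: "mult (\<lambda>z. z ^ n) f \<in> H2" by (intro mult_power_H2 f)
    show ?case
    proof (cases P)
      case (pCons a Q)
      then show ?thesis
        using Suc[of Q] unfolding eq
        by (simp add: mult_poly_pCons cinner_simps cinner_Tz_unit_fun h cinner_Tz Tz_H2
            bshift_Tz mult_poly_H2 del: poly_pCons)
    qed
  qed
  obtain \<phi> where \<phi>: "square_integrable \<phi>" "f = abs_L2 \<phi>" by (rule L2_representative)
  have "AE z in circle. cmod (\<phi> z) \<le> 2 * 0"
  proof (rule AE_bounded_of_polynomials)
    show "integrable circle \<phi>" by (rule integral_cmod_le_norm(1)[OF \<phi>(1)])
    fix p :: "complex \<Rightarrow> real" assume "real_polynomial_function p"
    then have p2: "real_polynomial_function (\<lambda>z. (p z)\<^sup>2)"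
      unfolding power2_eq_square by (intro real_polynomial_function.intros(4))
    then obtain N P where NP: "\<And>z. cmod z = 1 \<Longrightarrow> of_real ((p z)\<^sup>2) * z ^ N = poly P z"
      using real_polynomial_on_circle by blast
    define w where "w = (\<lambda>z. complex_of_real ((p z)\<^sup>2))"
    have w: "w \<in> Linfty" unfolding w_def by (rule real_polynomial_Linfty[OF p2])
    have "(LINT z|circle. \<phi> z * of_real ((p z)\<^sup>2)) = cinner f (mult w unit_fun)"
      using Linfty_square_integrable[OF w square_integrable_const_one]
      by (simp add: unit_fun_def mult_abs_L2 w square_integrable_const_one \<phi> cinner_abs_L2)
        (simp add: w_def)
    also have "mult w unit_fun = mult (\<lambda>z. cnj z ^ N) (mult (poly P) unit_fun)"
    proof (rule mult_eqI_circle[symmetric])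
      fix z :: complex assume z: "cmod z = 1"
      have "cnj z ^ N * poly P z = w z * (cnj z * z) ^ N"
        by (simp add: NP[OF z, symmetric] w_def power_mult_distrib)
      then show "w z = cnj z ^ N * poly P z" by (simp only: z_cnj[OF z] power_one mult_1_right)
    qed (use w in auto)
    also have "cinner f \<dots> = 0"
      using orth_power[of N P] by (simp add: cinner_mult_left)
    finally show "cmod (LINT z|circle. \<phi> z * of_real ((p z)\<^sup>2)) \<le> 0 * (LINT z|circle. (p z)\<^sup>2)" by simp
  qed
  then have "AE z in circle. \<phi> z = 0" by simp
  then have "(LINT z|circle. (cmod (\<phi> z))\<^sup>2) = (LINT z|circle. 0)"
    using \<phi> by (intro integral_cong_AE) (auto simp: square_integrable_def)
  then have "(norm f)\<^sup>2 = 0" using \<phi> by (simp add: norm_abs_L2)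
  then show "f = 0" by simp
qed

lemma polynomials_dense_H2:
  assumes K: "csubspace K" "closed K" "K \<subseteq> H2" and poly: "\<And>p. mult (poly p) unit_fun \<in> K"
  shows "H2 \<subseteq> K"
proof
  fix f assume f: "f \<in> H2"
  have in_K: "proj K f \<in> K" by (rule proj_in[OF K(1,2)])
  have "f - proj K f = 0"
    using in_K K(3) f proj_orth[OF K(1,2) poly] by (intro H2_eq_0I H2_intros) auto
  then show "f \<in> K" using in_K by simp
qed

section \<open>Nehari's theorem\<close>

lemma J_unit_fun: "J unit_fun = unit_fun"
  by (simp add: unit_fun_def J_abs_L2 square_integrable_const_one)

text \<open>For a real trigonometric polynomial \<open>p\<close>, write \<open>p(z) = z\<^sup>-\<^sup>N P(z)\<close> and \<open>p(cnj z) = z\<^sup>-\<^sup>N\<^sup>' R(z)\<close>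
  on the circle. As \<open>p\<close> is real, one of the two factors in \<open>\<integral> \<phi> p\<^sup>2\<close> may be conjugated, and the
  integral becomes the entry \<open>\<langle>E\<^sub>n R, P\<rangle>\<close> of the extension with \<open>n = N + N'\<close>. Both \<open>P\<close> and \<open>R\<close> have the
  norm of \<open>p\<close>, so the bound on \<open>E\<^sub>n\<close> is the estimate of \<open>AE_bounded_of_polynomials\<close>.\<close>

lemma hankel_Linfty_symbol:
  assumes "hankel_bounded M G"
  obtains \<phi> where "\<phi> \<in> Linfty" "\<And>p g. g \<in> H2 \<Longrightarrow>
    cinner (mult (\<lambda>z. poly p (cnj z)) (mult \<phi> unit_fun)) g = cinner (G (mult (poly p) unit_fun)) g"
proof -
  obtain E :: "nat \<Rightarrow> L2 \<Rightarrow> L2" where E0: "E 0 = G" and E: "\<And>n. hankel_bounded M (E n)"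
    and ext: "\<And>n f. f \<in> H2 \<Longrightarrow> E (Suc n) (Tz f) = E n f"
    using hankel_extensions[OF assms] by blast
  obtain \<Phi> where \<Phi>: "\<And>n p g. g \<in> H2 \<Longrightarrow>
    cinner (mult (\<lambda>z. z ^ n * poly p (cnj z)) \<Phi>) g = cinner (E n (mult (poly p) unit_fun)) g"
    using hankel_L2_symbol[of M E, OF E ext] by blast
  obtain \<phi> where \<phi>: "square_integrable \<phi>" "\<Phi> = abs_L2 \<phi>" by (rule L2_representative)
  have "AE z in circle. cmod (\<phi> z) \<le> 2 * M"
  proof (rule AE_bounded_of_polynomials)
    show "integrable circle \<phi>" by (rule integral_cmod_le_norm(1)[OF \<phi>(1)])
    fix p :: "complex \<Rightarrow> real" assume p: "real_polynomial_function p"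
    have p': "real_polynomial_function (\<lambda>z. p (cnj z))"
      using real_polynomial_function_compose[OF polynomial_function_bounded_linear[OF bounded_linear_cnj] p]
      by (simp add: o_def)
    obtain N P where P: "\<And>z. cmod z = 1 \<Longrightarrow> of_real (p z) * z ^ N = poly P z"
      using real_polynomial_on_circle[OF p] by blast
    obtain N' R where R: "\<And>z. cmod z = 1 \<Longrightarrow> of_real (p (cnj z)) * z ^ N' = poly R z"
      using real_polynomial_on_circle[OF p'] by blast
    define w where "w = (\<lambda>z. complex_of_real (p z))"
    have w: "w \<in> Linfty" "(\<lambda>z. w (cnj z)) \<in> Linfty"
      unfolding w_def by (intro real_polynomial_Linfty p p')+
    have norm_w: "(norm (mult w unit_fun))\<^sup>2 = (LINT z|circle. (p z)\<^sup>2)"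
      using w unfolding w_def by (intro norm_mult_unit_fun)
    have eq_P: "mult (poly P) unit_fun = mult (\<lambda>z. z ^ N) (mult w unit_fun)"
      using w by (intro mult_eqI_circle[symmetric]) (auto simp: P[symmetric] w_def)
    have eq_R: "mult (poly R) unit_fun = mult (\<lambda>z. z ^ N') (J (mult w unit_fun))"
      using w by (subst J_mult)
        (auto simp: J_unit_fun R[symmetric] w_def intro!: mult_eqI_circle[symmetric])
    have norm_P: "norm (mult (poly P) unit_fun) = norm (mult w unit_fun)"
      unfolding eq_P by (rule norm_mult_unimodular) (auto simp: norm_power)
    have norm_R: "norm (mult (poly R) unit_fun) = norm (mult w unit_fun)"
      unfolding eq_R norm_J[symmetric, of "mult w unit_fun"]
      by (rule norm_mult_unimodular) (auto simp: norm_power)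
    have "(LINT z|circle. \<phi> z * of_real ((p z)\<^sup>2)) = cinner (mult w \<Phi>) (mult w unit_fun)"
      using Linfty_square_integrable[OF w(1) square_integrable_const_one]
        Linfty_square_integrable[OF w(1) \<phi>(1)]
      by (simp add: unit_fun_def mult_abs_L2 w square_integrable_const_one \<phi> cinner_abs_L2)
        (simp add: w_def power2_eq_square mult_ac)
    also have "mult w unit_fun = mult (\<lambda>z. cnj z ^ N) (mult (poly P) unit_fun)"
      unfolding eq_P by (rule mult_cancel[symmetric]) (auto simp: z_cnj simp flip: power_mult_distrib)
    also have "cinner (mult w \<Phi>) \<dots> = cinner (mult (\<lambda>z. z ^ N) (mult w \<Phi>)) (mult (poly P) unit_fun)"
      by (simp add: cinner_mult_left)
    also have "mult (\<lambda>z. z ^ N) (mult w \<Phi>) = mult (\<lambda>z. z ^ (N + N') * poly R (cnj z)) \<Phi>"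
    proof (rule mult_eqI_circle)
      fix z :: complex assume z: "cmod z = 1"
      have "z ^ (N + N') * poly R (cnj z) = z ^ N * w z * (z * cnj z) ^ N'"
        using R[of "cnj z"] z by (simp add: w_def power_add power_mult_distrib mult_ac flip: R)
      then show "z ^ (N + N') * poly R (cnj z) = z ^ N * w z"
        by (simp only: z_cnj[OF z] power_one mult_1_right)
    qed (auto intro: w Linfty_mult)
    also have "cinner \<dots> (mult (poly P) unit_fun)
        = cinner (E (N + N') (mult (poly R) unit_fun)) (mult (poly P) unit_fun)"
      by (rule \<Phi>[OF mult_poly_H2])
    also have "cmod \<dots> \<le> norm (E (N + N') (mult (poly R) unit_fun)) * norm (mult (poly P) unit_fun)"
      by (rule cinner_Cauchy_Schwarz)
    also have "\<dots> \<le> M * norm (mult (poly R) unit_fun) * norm (mult (poly P) unit_fun)"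
      by (intro mult_right_mono hankel_boundedD(4)[OF E] mult_poly_H2) simp
    also have "\<dots> = M * (LINT z|circle. (p z)\<^sup>2)"
      unfolding norm_P norm_R norm_w[symmetric] by (simp add: power2_eq_square)
    finally show "cmod (LINT z|circle. \<phi> z * of_real ((p z)\<^sup>2)) \<le> M * (LINT z|circle. (p z)\<^sup>2)" .
  qed
  then have L: "\<phi> \<in> Linfty" using \<phi> by (auto simp: Linfty_def square_integrable_def)
  have \<Phi>_eq: "mult \<phi> unit_fun = \<Phi>"
    using \<phi> L by (simp add: unit_fun_def mult_abs_L2 square_integrable_const_one)
  show ?thesis
  proof (rule that[OF L])
    fix p g assume "g \<in> H2"
    then show "cinner (mult (\<lambda>z. poly p (cnj z)) (mult \<phi> unit_fun)) g
        = cinner (G (mult (poly p) unit_fun)) g"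
      using \<Phi>[of g 0 p] by (simp add: \<Phi>_eq E0)
  qed
qed

lemma continuous_on_subspace_operator:
  assumes K: "csubspace K" and add: "\<And>f g. f \<in> K \<Longrightarrow> g \<in> K \<Longrightarrow> A (f + g) = A f + A g"
    and bound: "\<And>f. f \<in> K \<Longrightarrow> norm (A f) \<le> C * norm (f :: L2)"
  shows "continuous_on K (A :: L2 \<Rightarrow> L2)"
proof (rule continuous_onI)
  fix x e assume x: "x \<in> K" and e: "(e::real) > 0"
  have diff: "norm (A y - A x) \<le> \<bar>C\<bar> * norm (y - x)" if y: "y \<in> K" for y
  proof -
    have "A y = A (y - x) + A x"
      using add[of "y - x" x] csubspaceD(4)[OF K y x] x by simp
    moreover have "C * norm (y - x) \<le> \<bar>C\<bar> * norm (y - x)" by (intro mult_right_mono) auto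
    ultimately show ?thesis using bound[OF csubspaceD(4)[OF K y x]] by simp
  qed
  have "dist (A y) (A x) \<le> e" if y: "y \<in> K" and "dist y x < e / (\<bar>C\<bar> + 1)" for y
  proof -
    have "\<bar>C\<bar> * norm (y - x) \<le> (\<bar>C\<bar> + 1) * norm (y - x)" by (intro mult_right_mono) auto
    also have "\<dots> \<le> e" using that(2) by (simp add: dist_norm field_simps)
    finally show ?thesis using diff[OF y] by (simp add: dist_norm)
  qed
  then show "\<exists>d>0. \<forall>y\<in>K. dist y x < d \<longrightarrow> dist (A y) (A x) \<le> e"
    using e by (intro exI[of _ "e / (\<bar>C\<bar> + 1)"]) auto
qed

lemma Hankel_add: "Hankel \<phi> (f + g) = Hankel \<phi> f + Hankel \<phi> g"
  and Hankel_scaleC: "Hankel \<phi> (scaleC c f) = scaleC c (Hankel \<phi> f)"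
  by (simp_all add: Hankel_def J_add J_scaleC mult_add mult_scaleC
      proj_add proj_scaleC csubspace_H2 closed_H2)

lemma Hankel_bounded:
  assumes "\<phi> \<in> Linfty" obtains C where "\<And>f. norm (Hankel \<phi> f) \<le> C * norm f"
proof -
  obtain C where C: "\<And>f. norm (mult \<phi> f) \<le> C * norm f" using mult_bounded[OF assms] by blast
  have "norm (Hankel \<phi> f) \<le> C * norm f" for f
    using norm_proj_le[OF csubspace_H2 closed_H2, of "mult \<phi> (J f)"] C[of "J f"]
    by (simp add: Hankel_def norm_J)
  then show ?thesis by (rule that)
qed

text \<open>Both operators are continuous on \<open>H2\<close> and agree on the polynomials, which are dense.\<close>

theorem Nehari:
  assumes G: "hankel_bounded M G"
  obtains \<phi> where "\<phi> \<in> Linfty" "\<And>f. f \<in> H2 \<Longrightarrow> Hankel \<phi> f = G f"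
proof -
  note GD = hankel_boundedD[OF G]
  obtain \<phi> where \<phi>: "\<phi> \<in> Linfty" and sym: "\<And>p g. g \<in> H2 \<Longrightarrow>
    cinner (mult (\<lambda>z. poly p (cnj z)) (mult \<phi> unit_fun)) g = cinner (G (mult (poly p) unit_fun)) g"
    using hankel_Linfty_symbol[OF G] by blast
  define K where "K = {f \<in> H2. Hankel \<phi> f - G f = 0}"
  have poly_K: "mult (poly p) unit_fun \<in> K" for p
  proof -
    have "J (mult (poly p) unit_fun) = mult (\<lambda>z. poly p (cnj z)) unit_fun"
      by (simp add: J_mult J_unit_fun)
    then have "mult \<phi> (J (mult (poly p) unit_fun)) = mult (\<lambda>z. poly p (cnj z)) (mult \<phi> unit_fun)"
      by (simp add: mult_commute)
    then have "Hankel \<phi> (mult (poly p) unit_fun) = G (mult (poly p) unit_fun)"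
      unfolding Hankel_def
      by (intro proj_eqI csubspace_H2 GD mult_poly_H2) (simp add: cinner_diff_left sym)
    then show ?thesis by (simp add: K_def mult_poly_H2)
  qed
  have "csubspace K"
    using GD(6)[OF unit_fun_H2 unit_fun_H2] Hankel_scaleC[of \<phi> 0 0]
    by (auto simp: csubspace_def K_def H2_intros Hankel_add Hankel_scaleC GD)
  have "closed K"
    unfolding K_def
  proof (rule continuous_closed_preimage_constant[OF _ closed_H2])
    obtain C where C: "\<And>f. norm (Hankel \<phi> f) \<le> C * norm f" using Hankel_bounded[OF \<phi>] by blast
    show "continuous_on H2 (\<lambda>f. Hankel \<phi> f - G f)"
      by (intro continuous_on_diff continuous_on_subspace_operator[OF csubspace_H2, of _ C]
          continuous_on_subspace_operator[OF csubspace_H2, of G M]) (auto simp: Hankel_add GD C)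
  qed
  have "H2 \<subseteq> K"
    using \<open>csubspace K\<close> \<open>closed K\<close> poly_K by (intro polynomials_dense_H2) (auto simp: K_def)
  then have "Hankel \<phi> f = G f" if "f \<in> H2" for f
    using that by (auto simp: K_def)
  with \<phi> show ?thesis by (rule that)
qed

section \<open>Inner functions multiply the Hardy space into itself\<close>

text \<open>On a smaller circle the power series of \<open>u\<close> converges absolutely and uniformly and may be
  integrated term by term; only positive powers of \<open>z\<close> occur.\<close>

lemma integral_dilation:
  assumes u: "u \<in> Hinfty" and r: "0 \<le> r" "r < (1::real)"
  shows "(LINT z|circle. u (of_real r * z) * z ^ Suc m) = 0"
proof -
  interpret finite_measure circle by (rule finite_measure_circle)
  define a where "a n = (deriv ^^ n) u 0 / fact n" for n
  have sums: "(\<lambda>n. a n * w ^ n) sums u w" if "cmod w < 1" for w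
    using holomorphic_power_series[of u 0 1 w] u that by (simp add: Hinfty_def a_def)
  obtain s where s: "r < s" "s < 1" using dense[OF r(2)] by blast
  have "summable (\<lambda>n. a n * of_real s ^ n)"
    using sums[of "of_real s"] s r by (simp add: sums_iff)
  then have abs: "summable (\<lambda>n. cmod (a n * of_real r ^ n))"
    using s r by (intro powser_insidea[of _ "of_real s"]) auto
  have "(LINT z|circle. u (of_real r * z) * z ^ Suc m)
      = (LINT z|circle. (\<Sum>n. a n * of_real r ^ n * z ^ Suc (n + m)))"
  proof (rule Bochner_Integration.integral_cong[OF refl])
    fix z assume "z \<in> space circle"
    then have "cmod (of_real r * z) < 1" using r by (simp add: norm_mult)
    from sums_mult2[OF sums[OF this], of "z ^ Suc m"]
    show "u (of_real r * z) * z ^ Suc m = (\<Sum>n. a n * of_real r ^ n * z ^ Suc (n + m))"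
      by (simp add: sums_iff power_mult_distrib power_add mult_ac)
  qed
  also have "\<dots> = (\<Sum>n. LINT z|circle. a n * of_real r ^ n * z ^ Suc (n + m))"
  proof (rule integral_suminf)
    have m: "(\<lambda>z. a n * of_real r ^ n * z ^ Suc (n + m)) \<in> borel_measurable circle" for n
      by (intro borel_measurable_circleI borel_measurable_continuous_onI continuous_intros)
    show "integrable circle (\<lambda>z. a n * of_real r ^ n * z ^ Suc (n + m))" for n
      by (rule integrable_const_bound[OF _ m, where B="cmod (a n * of_real r ^ n)"])
        (auto intro!: AE_I2 simp: norm_mult norm_power)
    show "AE z in circle. summable (\<lambda>n. norm (a n * of_real r ^ n * z ^ Suc (n + m)))"
      using abs by (intro AE_I2) (simp add: norm_mult norm_power)
    have "(LINT z|circle. norm (a n * of_real r ^ n * z ^ Suc (n + m))) = cmod (a n * of_real r ^ n)" for n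
    proof -
      have "(LINT z|circle. norm (a n * of_real r ^ n * z ^ Suc (n + m)))
          = (LINT z|circle. cmod (a n * of_real r ^ n))"
        by (rule Bochner_Integration.integral_cong) (auto simp: norm_mult norm_power)
      then show ?thesis using emeasure_space_circle by (simp add: measure_def)
    qed
    then show "summable (\<lambda>n. LINT z|circle. norm (a n * of_real r ^ n * z ^ Suc (n + m)))"
      using abs by (simp only:)
  qed
  also have "\<dots> = 0" by (simp add: circle_integral_power del: power_Suc)
  finally show ?thesis .
qed

text \<open>Radial limits are limits of dilations, dominated by the bound of \<open>u\<close>.\<close>

lemma integral_boundary:
  assumes u: "inner_function u" and b: "boundary u \<in> Linfty"
  shows "(LINT z|circle. boundary u z * z ^ Suc m) = 0"
proof -
  interpret finite_measure circle by (rule finite_measure_circle)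
  have uH: "u \<in> Hinfty" using u by (simp add: inner_function_def)
  then obtain C where "\<forall>w\<in>ball 0 1. cmod (u w) \<le> C"
    unfolding Hinfty_def bounded_iff by blast
  then have C: "cmod (u w) \<le> C" if "cmod w < 1" for w using that by simp
  define r where "r n = 1 - 1 / real (Suc (Suc n))" for n
  have r: "0 \<le> r n" "r n < 1" for n by (auto simp: r_def field_simps)
  have "r \<longlonglongrightarrow> 1 - 0"
    unfolding r_def
    by (intro tendsto_intros LIMSEQ_Suc[of "\<lambda>n. 1 / real (Suc n)"])
      (use LIMSEQ_inverse_real_of_nat in \<open>simp add: inverse_eq_divide\<close>)
  moreover have "r n \<noteq> 1" for n using r(2)[of n] by simp
  ultimately have lim_r: "filterlim r (at_left 1) sequentially"
    using r by (simp add: filterlim_at)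
  have lim: "AE z in circle. (\<lambda>n. u (of_real (r n) * z)) \<longlonglongrightarrow> boundary u z"
  proof -
    have "AE z in circle. \<exists>l. has_radial_limit u z l \<and> cmod l = 1"
      using u by (simp add: inner_function_def)
    then show ?thesis
    proof eventually_elim
      fix z assume "\<exists>l. has_radial_limit u z l \<and> cmod l = 1"
      then obtain l where l: "((\<lambda>r. u (of_real r * z)) \<longlongrightarrow> l) (at_left (1::real))"
        by (auto simp: has_radial_limit_def)
      then have "boundary u z = l" unfolding boundary_def by (intro tendsto_Lim) auto
      with filterlim_compose[OF l lim_r] show "(\<lambda>n. u (of_real (r n) * z)) \<longlonglongrightarrow> boundary u z"
        by simp
    qed
  qed
  have bm [measurable]: "boundary u \<in> borel_measurable circle" using b by (simp add: Linfty_def)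
  have pm [measurable]: "(\<lambda>z::complex. z ^ n) \<in> borel_measurable circle" for n
    by (intro borel_measurable_circleI borel_measurable_continuous_onI continuous_intros)
  have um [measurable]: "(\<lambda>z. u (of_real (r n) * z)) \<in> borel_measurable circle" for n
  proof -
    have "continuous_on (ball 0 1) u" using uH by (auto simp: Hinfty_def holomorphic_on_imp_continuous_on)
    then have "continuous_on (sphere 0 1) (\<lambda>z. u (of_real (r n) * z))"
      by (rule continuous_on_compose2) (use r in \<open>auto intro!: continuous_intros simp: norm_mult\<close>)
    then show ?thesis
      unfolding measurable_cong_sets[OF sets_circle refl]
      by (rule borel_measurable_continuous_on_restrict)
  qed
  have "(\<lambda>n. LINT z|circle. u (of_real (r n) * z) * z ^ Suc m) \<longlonglongrightarrow> (LINT z|circle. boundary u z * z ^ Suc m)"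
  proof (rule integral_dominated_convergence[where w="\<lambda>_. C"])
    show "AE z in circle. (\<lambda>n. u (of_real (r n) * z) * z ^ Suc m) \<longlonglongrightarrow> boundary u z * z ^ Suc m"
      using lim by eventually_elim (intro tendsto_intros)
    show "AE z in circle. norm (u (of_real (r n) * z) * z ^ Suc m) \<le> C" for n
      using r[of n] by (intro AE_I2) (auto simp: norm_mult norm_power intro!: C)
  qed (auto simp del: power_Suc)
  then show ?thesis
    by (simp add: integral_dilation[OF uH r] LIMSEQ_const_iff del: power_Suc)
qed

text \<open>The functions \<open>v k\<close> are the conjugates of \<open>u z\<^sup>k\<^sup>+\<^sup>1\<close>, and \<open>u f\<close> lies in \<open>H2\<close> if and only if \<open>f\<close> is
  orthogonal to all of them. For constant \<open>f\<close> this is \<open>integral_boundary\<close>, for monomials it follows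
  since multiplying \<open>f\<close> by \<open>z\<close> turns \<open>v k\<close> into \<open>v (k + 1)\<close>, and in general by density.\<close>

lemma mult_boundary_H2:
  assumes u: "inner_function u" and f: "f \<in> H2"
  shows "mult (boundary u) f \<in> H2"
proof (cases "boundary u \<in> Linfty")
  case False
  \<comment> \<open>Here \<open>mult\<close> has its default value 0.\<close>
  then have "mult (boundary u) f = 0" by transfer (simp add: L2_rel_def)
  then show ?thesis by (simp add: H2_intros)
next
  case b: True
  define v where "v k = mult (\<lambda>z. cnj (boundary u z)) (mult (\<lambda>z. cnj z ^ Suc k) unit_fun)" for k
  have v_shift: "mult cnj (v k) = v (Suc k)" for k
  proof -
    have "mult cnj (mult (\<lambda>z. cnj z ^ Suc k) unit_fun) = mult (\<lambda>z. cnj z ^ Suc (Suc k)) unit_fun"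
      by (rule mult_eqI_circle) (auto intro: Linfty_continuous(4)[of "Suc k", simplified]
          Linfty_continuous(4)[of "Suc (Suc k)", simplified])
    then show ?thesis unfolding v_def by (subst mult_commute) simp
  qed
  have one: "cinner unit_fun (v k) = 0" for k
  proof -
    have si: "square_integrable (\<lambda>z. cnj z ^ Suc k * 1)"
      by (intro Linfty_square_integrable Linfty_continuous square_integrable_const_one)
    have "v k = abs_L2 (\<lambda>z. cnj (boundary u z) * (cnj z ^ Suc k * 1))"
      unfolding v_def unit_fun_def
      by (subst mult_abs_L2[OF Linfty_continuous(4) square_integrable_const_one],
          rule mult_abs_L2[OF Linfty_cnj[OF b] si])
    then have "cinner unit_fun (v k) = (LINT z|circle. 1 * cnj (cnj (boundary u z) * (cnj z ^ Suc k * 1)))"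
      unfolding unit_fun_def
      by (simp only: cinner_abs_L2[OF square_integrable_const_one Linfty_square_integrable[OF Linfty_cnj[OF b] si]])
    also have "\<dots> = (LINT z|circle. boundary u z * z ^ Suc k)" by simp
    finally show ?thesis by (simp only: integral_boundary[OF u b])
  qed
  have poly: "cinner (mult (poly p) unit_fun) (v k) = 0" for p k
  proof (induction p arbitrary: k)
    case 0
    show ?case by (simp add: mult_const)
  next
    case (pCons a p)
    then show ?case
      by (simp add: mult_poly_pCons cinner_simps one Tz_def cinner_mult_left v_shift del: poly_pCons)
  qed
  have "H2 \<subseteq> {f \<in> H2. cinner f (v k) = 0}" for k
  proof (rule polynomials_dense_H2)
    show "csubspace {f \<in> H2. cinner f (v k) = 0}"
      by (auto simp: csubspace_def H2_intros cinner_simps)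
    show "closed {f \<in> H2. cinner f (v k) = 0}"
      by (intro continuous_closed_preimage_constant closed_H2 continuous_on_cinner_left)
  qed (auto simp: poly mult_poly_H2)
  then have "cinner f (v k) = 0" for k using f by blast
  then show ?thesis
    unfolding H2_iff v_def by (simp add: cinner_mult_left b del: power_Suc)
qed

section \<open>The model space and the model operator\<close>

lemma model_space_H2: "f \<in> model_space u \<Longrightarrow> f \<in> H2"
  by (simp add: model_space_def ominus_def)

lemma csubspace_model_space: "csubspace (model_space u)"
  by (auto simp: csubspace_def model_space_def ominus_def H2_intros cinner_simps)

lemma closed_model_space: "closed (model_space u)"
proof -
  have "model_space u = H2 \<inter> (\<Inter>g\<in>mult (boundary u) ` H2. {f. cinner f g = 0})"
    by (auto simp: model_space_def ominus_def)
  also have "closed \<dots>"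
    by (intro closed_Int closed_H2 closed_INT ballI closed_Collect_eq
        continuous_on_cinner_left continuous_on_const)
  finally show ?thesis .
qed

lemmas proj_model = proj_in[OF csubspace_model_space closed_model_space]
  proj_orth[OF csubspace_model_space closed_model_space]

lemma bshift_model_space:
  assumes u: "inner_function u" and f: "f \<in> model_space u"
  shows "bshift f \<in> model_space u"
proof -
  have "cinner (bshift f) (mult (boundary u) g) = 0" if g: "g \<in> H2" for g
  proof -
    have "cinner (bshift f) (mult (boundary u) g) = cinner f (Tz (mult (boundary u) g))"
      by (intro cinner_Tz[symmetric] mult_boundary_H2 u g model_space_H2[OF f])
    also have "Tz (mult (boundary u) g) = mult (boundary u) (Tz g)"
      unfolding Tz_def by (rule mult_commute)
    also have "cinner f \<dots> = 0"
      using f Tz_H2[OF g] by (simp add: model_space_def ominus_def)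
    finally show ?thesis .
  qed
  then show ?thesis
    using bshift_H2[OF model_space_H2[OF f]] by (auto simp: model_space_def ominus_def)
qed

text \<open>\<open>bshift g\<close> is adjoint to the shift on all of \<open>H2\<close> and stays in the model space; uniqueness of the
  adjoint does the rest.\<close>

lemma adj_model_operator:
  assumes u: "inner_function u" and g: "g \<in> model_space u"
  shows "adj (model_space u) (model_operator u) g = bshift g"
  unfolding adj_def
proof (rule the_equality)
  have eq: "cinner (model_operator u f) g = cinner f (bshift g)" if f: "f \<in> model_space u" for f
  proof -
    have "cinner (model_operator u f) g = cinner (Tz f) g"
      unfolding model_operator_def by (rule cinner_proj[OF csubspace_model_space closed_model_space g])
    also have "\<dots> = cnj (cinner g (Tz f))" by (rule cinner_commute)
    also have "cinner g (Tz f) = cinner (bshift g) f"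
      by (intro cinner_Tz model_space_H2[of _ u] f g)
    also have "cnj \<dots> = cinner f (bshift g)" by (rule cinner_commute[symmetric])
    finally show ?thesis .
  qed
  then show "bshift g \<in> model_space u \<and>
      (\<forall>f\<in>model_space u. cinner (model_operator u f) g = cinner f (bshift g))"
    by (simp add: bshift_model_space u g)
  fix h assume h: "h \<in> model_space u \<and> (\<forall>f\<in>model_space u. cinner (model_operator u f) g = cinner f h)"
  then have "h - bshift g \<in> model_space u"
    by (intro csubspaceD(4)[OF csubspace_model_space] bshift_model_space u g) auto
  then have "cinner (h - bshift g) h = cinner (h - bshift g) (bshift g)"
    using h eq by metis
  then have "cinner (h - bshift g) (h - bshift g) = 0" by (simp add: cinner_diff_right)
  then show "h = bshift g" by (simp add: cinner_self)
qed

text \<open>The orthogonal complement of the model space in \<open>H2\<close> is invariant under the shift, because the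
  model space is invariant under its adjoint. So the component of \<open>f\<close> that the projection removes
  stays invisible after the shift.\<close>

lemma model_operator_proj:
  assumes u: "inner_function u" and f: "f \<in> H2"
  shows "model_operator u (proj (model_space u) f) = proj (model_space u) (Tz f)"
  unfolding model_operator_def
proof (rule proj_eqI[OF csubspace_model_space])
  show "proj (model_space u) (Tz f) \<in> model_space u" by (rule proj_model)
  fix h assume h: "h \<in> model_space u"
  let ?g = "proj (model_space u) f - f"
  have g: "?g \<in> H2" by (intro H2_intros f model_space_H2[OF proj_model(1)])
  have "cinner (Tz ?g) h = cnj (cinner (bshift h) ?g)"
    using cinner_Tz[OF model_space_H2[OF h] g] by (metis cinner_commute)
  also have "\<dots> = cinner ?g (bshift h)" by (rule cinner_commute[symmetric])
  also have "\<dots> = 0"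
    using proj_model(2)[OF bshift_model_space[OF u h], of f] by (simp add: cinner_simps)
  finally show "cinner (Tz (proj (model_space u) f) - proj (model_space u) (Tz f)) h = 0"
    using proj_model(2)[OF h, of "Tz f"] by (simp add: Tz_diff cinner_simps)
qed

lemma Hankel_Tz:
  assumes "\<phi> \<in> Linfty" "f \<in> H2" shows "Hankel \<phi> (Tz f) = bshift (Hankel \<phi> f)"
  unfolding Hankel_def
proof (rule proj_eqI[OF csubspace_H2])
  let ?g = "mult \<phi> (J f)"
  show "bshift (proj H2 ?g) \<in> H2" by (intro bshift_H2 H2_intros)
  fix h assume h: "h \<in> H2"
  have "mult \<phi> (J (Tz f)) = mult cnj ?g"
    unfolding Tz_def by (subst J_mult) (simp_all add: mult_commute)
  then have "cinner (mult \<phi> (J (Tz f))) h = cinner ?g (Tz h)"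
    by (simp add: cinner_mult_left Tz_def)
  also have "\<dots> = cinner (proj H2 ?g) (Tz h)"
    by (rule cinner_proj[OF csubspace_H2 closed_H2 Tz_H2[OF h], symmetric])
  also have "\<dots> = cinner (bshift (proj H2 ?g)) h"
    by (intro cinner_Tz h H2_intros)
  finally show "cinner (mult \<phi> (J (Tz f)) - bshift (proj H2 ?g)) h = 0"
    by (simp add: cinner_diff_left)
qed

section \<open>Operators intertwined by the model operator\<close>

lemma block_matrix_iff:
  fixes X :: "L2 \<Rightarrow> L2"
  assumes X: "X \<in> bounded_operators (model_space u)"
  shows "has_block_matrix H2 (model_space u) A X (\<lambda>_. 0) (\<lambda>_. 0) (\<lambda>_. 0) \<longleftrightarrow>
    (\<forall>f\<in>H2. A f = X (proj (model_space u) f))"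
proof
  let ?Q = "model_space u"
  assume block: "has_block_matrix H2 ?Q A X (\<lambda>_. 0) (\<lambda>_. 0) (\<lambda>_. 0)"
  show "\<forall>f\<in>H2. A f = X (proj ?Q f)"
  proof
    fix f assume f: "f \<in> H2"
    have "f - proj ?Q f \<in> H2 \<ominus> ?Q"
      using proj_model(2)[of _ u f] f model_space_H2[OF proj_model(1)]
      by (auto simp: ominus_def H2_intros)
    with block have "A (proj ?Q f + (f - proj ?Q f)) = X (proj ?Q f) + 0 + (0 + 0)"
      unfolding has_block_matrix_def using proj_model(1) by blast
    then show "A f = X (proj ?Q f)" by simp
  qed
next
  let ?Q = "model_space u"
  assume A: "\<forall>f\<in>H2. A f = X (proj ?Q f)"
  show "has_block_matrix H2 ?Q A X (\<lambda>_. 0) (\<lambda>_. 0) (\<lambda>_. 0)"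
    unfolding has_block_matrix_def
  proof (intro ballI conjI)
    fix f g assume f: "f \<in> ?Q" and g: "g \<in> H2 \<ominus> ?Q"
    show "X f \<in> ?Q" using X f by (simp add: bounded_operators_def)
    show "0 \<in> ?Q" by (rule csubspaceD(1)[OF csubspace_model_space])
    show "0 \<in> H2 \<ominus> ?Q" "0 \<in> H2 \<ominus> ?Q" by (simp_all add: ominus_def H2_intros)
    have "proj ?Q (f + g) = f"
      using g by (intro proj_eqI csubspace_model_space f) (simp add: ominus_def)
    moreover have "f + g \<in> H2" using g by (intro H2_intros model_space_H2[OF f]) (simp add: ominus_def)
    ultimately show "A (f + g) = X f + 0 + (0 + 0)" using A by simp
  qed
qed

text \<open>Passing from \<open>f\<close> to its projection keeps the numerator of the quotient and does not increase the
  denominator. If the projection is 0, both numerators vanish.\<close>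

lemma op_norm_compression:
  assumes X: "X \<in> bounded_operators (model_space u)"
    and A: "\<And>f. f \<in> H2 \<Longrightarrow> A f = X (proj (model_space u) f)"
  shows "op_norm H2 A = op_norm (model_space u) X"
proof -
  let ?Q = "model_space u"
  obtain C where "\<forall>f\<in>?Q. norm (X f) \<le> C * norm f"
    using X unfolding bounded_operators_def by blast
  then have C: "norm (X f) \<le> C * norm f" if "f \<in> ?Q" for f using that by blast
  have zero: "0 \<in> ?Q" "0 \<in> H2" "X 0 = 0"
    using csubspaceD(1)[OF csubspace_model_space, of u] C[of 0] by (auto simp: H2_intros)
  have proj_le: "norm (proj ?Q f) \<le> norm f" for f
    by (rule norm_proj_le[OF csubspace_model_space closed_model_space])
  have bd_X: "norm (X f) / norm f \<le> \<bar>C\<bar>" if "f \<in> ?Q" for f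
  proof (cases "f = 0")
    case False
    have "norm (X f) \<le> \<bar>C\<bar> * norm f"
      by (rule order_trans[OF C[OF that]]) (intro mult_right_mono, auto)
    then show ?thesis using False by (simp add: divide_le_eq)
  qed simp
  have le: "norm (A f) / norm f \<le> norm (X (proj ?Q f)) / norm (proj ?Q f)" if "f \<in> H2" for f
  proof (cases "proj ?Q f = 0")
    case True
    then show ?thesis using that by (simp add: A zero)
  next
    case False
    then show ?thesis using that proj_le[of f] by (simp add: A frac_le)
  qed
  have eq: "A f = X f" if "f \<in> ?Q" for f
    using that by (simp add: A model_space_H2 proj_ident csubspace_model_space)
  show ?thesis
    unfolding op_norm_def
  proof (rule antisym)
    show "(SUP f\<in>H2. norm (A f) / norm f) \<le> (SUP f\<in>?Q. norm (X f) / norm f)"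
    proof (rule cSUP_mono)
      show "bdd_above ((\<lambda>f. norm (X f) / norm f) ` ?Q)" by (rule bdd_aboveI2[where M="\<bar>C\<bar>"]) (rule bd_X)
    qed (use zero le proj_model(1) in blast)+
    show "(SUP f\<in>?Q. norm (X f) / norm f) \<le> (SUP f\<in>H2. norm (A f) / norm f)"
    proof (rule cSUP_mono)
      show "bdd_above ((\<lambda>f. norm (A f) / norm f) ` H2)"
        by (rule bdd_aboveI2[where M="\<bar>C\<bar>"]) (intro order_trans[OF le bd_X] proj_model(1))
      show "\<exists>g\<in>H2. norm (X f) / norm f \<le> norm (A g) / norm g" if "f \<in> ?Q" for f
        using that by (intro bexI[of _ f]) (auto simp: eq model_space_H2)
    qed (use zero in blast)
  qed
qed

theorem theorem1p2:
  fixes u :: "complex \<Rightarrow> complex" and X :: "L2 \<Rightarrow> L2"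
  assumes "inner_function u" and "X \<in> bounded_operators (model_space u)"
  shows
    "((\<forall>f\<in>model_space u. adj (model_space u) (model_operator u) (X f) = X (model_operator u f)) \<longleftrightarrow>
        (\<exists>\<phi>\<in>Linfty. has_block_matrix H2 (model_space u) (Hankel \<phi>) X (\<lambda>_. 0) (\<lambda>_. 0) (\<lambda>_. 0))) \<and>
     ((\<forall>f\<in>model_space u. adj (model_space u) (model_operator u) (X f) = X (model_operator u f)) \<longrightarrow>
        (\<forall>\<phi>\<in>Linfty. has_block_matrix H2 (model_space u) (Hankel \<phi>) X (\<lambda>_. 0) (\<lambda>_. 0) (\<lambda>_. 0) \<longrightarrow>
           (\<forall>f\<in>model_space u. X f = Hankel \<phi> f) \<and>
           op_norm H2 (Hankel \<phi>) = op_norm (model_space u) X))"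
proof -
  let ?Q = "model_space u"
  note u = assms(1) and X = assms(2)
  note block = block_matrix_iff[OF X]
  obtain C where "\<forall>f\<in>?Q. norm (X f) \<le> C * norm f"
    using X unfolding bounded_operators_def by blast
  then have C: "norm (X f) \<le> C * norm f" if "f \<in> ?Q" for f using that by blast
  have XD: "X f \<in> ?Q" "X (f + g) = X f + X g" "X (scaleC c f) = scaleC c (X f)"
    if "f \<in> ?Q" "g \<in> ?Q" for f g c
    using X that by (auto simp: bounded_operators_def)
  have intertwine: "(\<forall>f\<in>?Q. adj ?Q (model_operator u) (X f) = X (model_operator u f))
      \<longleftrightarrow> (\<forall>f\<in>H2. X (proj ?Q (Tz f)) = bshift (X (proj ?Q f)))"
    (is "?L \<longleftrightarrow> ?R")
  proof
    assume ?L
    show ?R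
    proof
      fix f assume f: "f \<in> H2"
      have Q: "proj ?Q f \<in> ?Q" by (rule proj_model)
      have "X (proj ?Q (Tz f)) = X (model_operator u (proj ?Q f))"
        by (simp only: model_operator_proj[OF u f])
      also have "\<dots> = adj ?Q (model_operator u) (X (proj ?Q f))"
        using \<open>?L\<close> Q by simp
      also have "\<dots> = bshift (X (proj ?Q f))"
        by (rule adj_model_operator[OF u XD(1)[OF Q Q]])
      finally show "X (proj ?Q (Tz f)) = bshift (X (proj ?Q f))" .
    qed
  next
    assume ?R
    show ?L
    proof
      fix f assume f: "f \<in> ?Q"
      have "proj ?Q f = f" by (rule proj_ident[OF csubspace_model_space f])
      then show "adj ?Q (model_operator u) (X f) = X (model_operator u f)"
        using \<open>?R\<close>[rule_format, OF model_space_H2[OF f]]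
        by (simp add: adj_model_operator[OF u XD(1)[OF f f]] model_operator_def)
    qed
  qed
  have "\<exists>\<phi>\<in>Linfty. \<forall>f\<in>H2. Hankel \<phi> f = X (proj ?Q f)"
    if comm: "\<forall>f\<in>H2. X (proj ?Q (Tz f)) = bshift (X (proj ?Q f))"
  proof -
    have "hankel_bounded \<bar>C\<bar> (\<lambda>f. X (proj ?Q f))"
      unfolding hankel_bounded_def
    proof (intro conjI ballI allI)
      fix f g c assume f: "f \<in> H2" and g: "g \<in> H2"
      have Q: "proj ?Q f \<in> ?Q" "proj ?Q g \<in> ?Q" by (rule proj_model)+
      show "X (proj ?Q f) \<in> H2" by (rule model_space_H2[OF XD(1)[OF Q]])
      show "X (proj ?Q (f + g)) = X (proj ?Q f) + X (proj ?Q g)"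
        by (simp add: proj_add[OF csubspace_model_space closed_model_space] XD(2)[OF Q])
      show "X (proj ?Q (scaleC c f)) = scaleC c (X (proj ?Q f))"
        by (simp add: proj_scaleC[OF csubspace_model_space closed_model_space] XD(3)[OF Q])
      have "norm (X (proj ?Q f)) \<le> \<bar>C\<bar> * norm (proj ?Q f)"
        by (rule order_trans[OF C[OF Q(1)]]) (intro mult_right_mono, auto)
      also have "\<dots> \<le> \<bar>C\<bar> * norm f"
        by (intro mult_left_mono norm_proj_le[OF csubspace_model_space closed_model_space]) auto
      finally show "norm (X (proj ?Q f)) \<le> \<bar>C\<bar> * norm f" .
      show "X (proj ?Q (Tz f)) = bshift (X (proj ?Q f))" using comm f by blast
    qed
    then show ?thesis using Nehari by metis
  qed
  moreover have "X (proj ?Q (Tz f)) = bshift (X (proj ?Q f))"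
    if "\<phi> \<in> Linfty" "\<forall>f\<in>H2. Hankel \<phi> f = X (proj ?Q f)" "f \<in> H2" for \<phi> f
    using Hankel_Tz[OF that(1,3)] that(2,3) Tz_H2[OF that(3)] by simp
  moreover have "(\<forall>f\<in>?Q. X f = Hankel \<phi> f) \<and> op_norm H2 (Hankel \<phi>) = op_norm ?Q X"
    if "\<forall>f\<in>H2. Hankel \<phi> f = X (proj ?Q f)" for \<phi>
    using that op_norm_compression[OF X, of "Hankel \<phi>"]
    by (simp add: model_space_H2 proj_ident[OF csubspace_model_space])
  ultimately show ?thesis unfolding intertwine block by blast
qed

end
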